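(* Let $0<\alpha\le 1$ and let $f:\mathbb{R}^d\to\mathbb{R}$ be differentiable and $\alpha$-strongly convex with minimizer $x^*$. Let $(X_t,Y_t)_{t\ge0}$ evolve following the randomized Hamiltonian flow (RHF) with constant refreshment rate $\gamma(t)=\sqrt{\frac{16\alpha}{5}}$, from any $X_0\in\mathbb{R}^d$ with $Y_0=0$. Then for any $t\ge 0$, $$\mathbb{E}\left[f(X_t)-f(x^* )\right]\le \exp\left(-\sqrt{\frac{\alpha}{5}}\,t\right)\mathbb{E}\left[f(X_0)-f(x^* )+\frac{\alpha}{10}\|X_0-x^*\|^2\right].$$
   Context: $\|\cdot\|$ is the Euclidean norm. A differentiable $f$ is $\alpha$-strongly convex if $f(y)\ge f(x)+\langle\nabla f(x),y-x\rangle+\frac{\alpha}{2}\|y-x\|^2$ for all $x,y\in\mathbb{R}^d$. Hamiltonian flow (HF): the ODE system $\dot X_t=Y_t$, $\dot Y_t=-\nabla f(X_t)$ on $\mathbb{R}^d\times\mathbb{R}^d$; it is taken to have a well-defined flow map (a unique solution for all $t\ge 0$ from every initial condition). Randomized Hamiltonian flow (RHF) with rate $\gamma(t)>0$: the piecewise deterministic stochastic process $$dX_t=Y_t\,dt,\qquad dY_t=-\nabla f(X_t)\,dt-Y_{t}\,dN_t,$$ where $dN_t=\sum_{k\ge1}\delta_{T_k}(dt)$ is a Poisson point process on $[0,\infty)$ with (possibly time-dependent) rate $\gamma(t)$ and event times $T_1<T_2<\cdots$, and the value of $Y$ multiplying $dN_t$ is its left limit. That is, $(X_t,Y_t)$ follows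 (HF) between consecutive event times, $X_t$ is continuous, and at each event time $T_k$ the velocity is reset: $Y_{T_k}=0$. The expectation is over the random event times (for deterministic $X_0$ the expectation on the right-hand side is trivial). *)

theory Defs
  imports "HOL-Probability.Probability"
begin

definition grad :: "('a::euclidean_space \<Rightarrow> real) \<Rightarrow> 'a \<Rightarrow> 'a" where
  "grad f x = (THE D. GDERIV f x :> D)"

lemma GDERIV_grad:
  fixes f :: "'a::euclidean_space \<Rightarrow> real"
  assumes "f differentiable (at x)"
  shows "GDERIV f x :> grad f x"
proof -
  obtain f' where f': "(f has_derivative f') (at x)"
    using assms by (auto simp: differentiable_def)
  then interpret linear f'
    by (rule has_derivative_linear)
  have "f' h = h \<bullet> (\<Sum>b\<in>Basis. f' b *\<^sub>R b)" for h
  proof -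
    have "f' h = f' (\<Sum>b\<in>Basis. (h \<bullet> b) *\<^sub>R b)"
      by (simp add: euclidean_representation)
    also have "\<dots> = h \<bullet> (\<Sum>b\<in>Basis. f' b *\<^sub>R b)"
      by (simp add: sum scale inner_sum_right mult.commute)
    finally show ?thesis .
  qed
  then have "f' = (\<lambda>h. h \<bullet> (\<Sum>b\<in>Basis. f' b *\<^sub>R b))"
    by (rule ext)
  then have D: "GDERIV f x :> (\<Sum>b\<in>Basis. f' b *\<^sub>R b)"
    using f' unfolding gderiv_def by metis
  have "D' = (\<Sum>b\<in>Basis. f' b *\<^sub>R b)" if "GDERIV f x :> D'" for D'
  proof -
    have "(\<lambda>h. h \<bullet> D') = (\<lambda>h. h \<bullet> (\<Sum>b\<in>Basis. f' b *\<^sub>R b))"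
      using that D unfolding gderiv_def by (rule has_derivative_unique)
    then show ?thesis
      by (metis vector_eq_ldot)
  qed
  with D show ?thesis
    unfolding grad_def by (rule theI)
qed

definition strongly_convex :: "real \<Rightarrow> ('a::euclidean_space \<Rightarrow> real) \<Rightarrow> bool" where
  "strongly_convex \<alpha> f \<longleftrightarrow>
     (\<forall>x y. f y \<ge> f x + grad f x \<bullet> (y - x) + \<alpha> / 2 * (norm (y - x))\<^sup>2)"

definition hamiltonian_solution ::
  "('a::euclidean_space \<Rightarrow> real) \<Rightarrow> real set \<Rightarrow> (real \<Rightarrow> 'a) \<Rightarrow> (real \<Rightarrow> 'a) \<Rightarrow> bool" where
  "hamiltonian_solution f S x y \<longleftrightarrow>
     (\<forall>t\<in>S. (x has_vector_derivative y t) (at t within S) \<and>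
            (y has_vector_derivative - grad f (x t)) (at t within S))"

text \<open>Solutions are total functions on the reals, so uniqueness is agreement on \<open>{0..}\<close>.\<close>

definition hamiltonian_flow_well_defined :: "('a::euclidean_space \<Rightarrow> real) \<Rightarrow> bool" where
  "hamiltonian_flow_well_defined f \<longleftrightarrow>
     (\<forall>x0 y0.
        (\<exists>x y. hamiltonian_solution f {0..} x y \<and> x 0 = x0 \<and> y 0 = y0) \<and>
        (\<forall>x y x' y'.
           hamiltonian_solution f {0..} x y \<and> x 0 = x0 \<and> y 0 = y0 \<and>
           hamiltonian_solution f {0..} x' y' \<and> x' 0 = x0 \<and> y' 0 = y0 \<longrightarrow>
           (\<forall>t\<ge>0. x t = x' t \<and> y t = y' t)))"

text \<open>
  A Poisson point process on \<open>[0, \<infinity>)\<close> with rate \<open>\<gamma>\<close>, given by its random, almost surely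
  locally finite set \<open>E \<omega>\<close> of event times \<open>T\<^sub>1 < T\<^sub>2 < \<dots>\<close>; the number of events in
  \<open>A\<close> is \<open>card (E \<omega> \<inter> A)\<close>.  Measurability of these counts is part of
  \<^term>\<open>prob_space.indep_vars\<close>, and finite families of sets are obtained by taking almost
  all \<open>A i\<close> empty.  The Poisson weights are written out because \<^const>\<open>poisson_pmf\<close> is
  specified only for positive means, whereas \<open>A\<close> may be a null set.
\<close>

definition poisson_point_process ::
  "'w measure \<Rightarrow> (real \<Rightarrow> real) \<Rightarrow> ('w \<Rightarrow> real set) \<Rightarrow> bool" where
  "poisson_point_process M \<gamma> E \<longleftrightarrow>
     prob_space M \<and>
     (\<forall>t\<ge>0. \<gamma> t > 0) \<and> (\<forall>b. set_integrable lborel {0..b} \<gamma>) \<and>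
     (AE \<omega> in M. E \<omega> \<subseteq> {0..} \<and> (\<forall>b. finite (E \<omega> \<inter> {0..b}))) \<and>
     (\<forall>A\<in>sets borel. A \<subseteq> {0..} \<and> bounded A \<longrightarrow>
        (\<forall>k. measure M {\<omega> \<in> space M. card (E \<omega> \<inter> A) = k} =
             (LINT t:A|lborel. \<gamma> t) ^ k / fact k * exp (- (LINT t:A|lborel. \<gamma> t)))) \<and>
     (\<forall>A :: nat \<Rightarrow> real set.
        (\<forall>i. A i \<in> sets borel \<and> A i \<subseteq> {0..} \<and> bounded (A i)) \<and> disjoint_family A \<longrightarrow>
        prob_space.indep_vars M (\<lambda>_. count_space UNIV) (\<lambda>i \<omega>. card (E \<omega> \<inter> A i)) UNIV)"

text \<open>
  The intervals \<open>[a, b)\<close> below may start, but not continue, at an event time.  The derivative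
  at \<open>a\<close> is therefore the right derivative, the dynamics restarts there from the reset
  velocity \<open>0\<close>, and \<open>Y\<close> is right-continuous with left limits.  Continuity of \<open>X\<close> joins
  consecutive intervals.
\<close>

definition randomized_hamiltonian_flow ::
  "'w measure \<Rightarrow> ('a::euclidean_space \<Rightarrow> real) \<Rightarrow> (real \<Rightarrow> real) \<Rightarrow> ('w \<Rightarrow> real set) \<Rightarrow>
   (real \<Rightarrow> 'w \<Rightarrow> 'a) \<Rightarrow> (real \<Rightarrow> 'w \<Rightarrow> 'a) \<Rightarrow> bool" where
  "randomized_hamiltonian_flow M f \<gamma> E X Y \<longleftrightarrow>
     poisson_point_process M \<gamma> E \<and>
     (\<forall>t\<ge>0. X t \<in> borel_measurable M \<and> Y t \<in> borel_measurable M) \<and>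
     (AE \<omega> in M.
        continuous_on {0..} (\<lambda>t. X t \<omega>) \<and>
        (\<forall>a b. 0 \<le> a \<and> a < b \<and> E \<omega> \<inter> {a<..<b} = {} \<longrightarrow>
           hamiltonian_solution f {a..<b} (\<lambda>t. X t \<omega>) (\<lambda>t. Y t \<omega>)) \<and>
        (\<forall>\<tau>\<in>E \<omega>. Y \<tau> \<omega> = 0))"

end

theory Submission
  imports Defs "HOL-Complex_Analysis.Great_Picard"
begin

text \<open>
  Let \<open>\<lambda> = sqrt (\<alpha> / 5)\<close>, so that the refreshment rate is \<open>4 * \<lambda>\<close>, and put \<open>u = x - xstar\<close>.  The
  Lyapunov function
  \<open>L (x, y) = f x - f xstar + (norm (y + \<lambda> *\<^sub>R u))\<^sup>2 / 2\<close>
  dominates \<open>f x - f xstar\<close> and equals \<open>f x - f xstar + \<alpha> / 10 * (norm u)\<^sup>2\<close> at zero velocity.  The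
  generator of the process, which is the derivative along the Hamiltonian flow plus \<open>4 * \<lambda>\<close> times
  the change of \<open>L\<close> under a velocity reset, maps \<open>L\<close> to something at most \<open>- \<lambda> * L\<close>: after strong
  convexity is applied between \<open>x\<close> and \<open>xstar\<close> the rest is minus a square (\<open>drift_nonpos\<close>).
  Hence the expectation of \<open>L\<close> decays like \<open>exp (- \<lambda> * t)\<close>.

  The passage from the generator to expectations needs that the state at a time is independent of the
  later events, although the process is given only path by path.  It is therefore approximated by
  a chain on a time grid that moves the events of each grid interval to its right end.  The chain is a
  function of finitely many independent Poisson counts, and one step contracts the expectation of
  \<open>L\<close> up to an error quadratic in the step size (\<open>one_step_contraction\<close>,
  \<open>grid_chain_expectation\<close>).  As the grid is refined the chain converges to the process along almost
  every path (\<open>grid_chain_tendsto_path\<close>), and the errors add up to something that vanishes.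

  Convergence along a path requires the flow to depend continuously on the initial state.  This
  follows from uniqueness of solutions by compactness (\<open>flow_continuous_on_sublevel\<close>), given that
  the gradient of a differentiable convex function is continuous (\<open>continuous_on_grad\<close>).  All
  bounds are uniform because neither the flow nor a reset raises the energy
  \<open>f x + (norm y)\<^sup>2 / 2\<close>, whose sublevel sets are compact.
\<close>

section \<open>The gradient of a differentiable convex function\<close>

lemma has_derivative_grad:
  fixes f :: "'a::euclidean_space \<Rightarrow> real"
  assumes "f differentiable (at x)"
  shows "(f has_derivative (\<lambda>h. h \<bullet> grad f x)) (at x)"
  using GDERIV_grad[OF assms] by (simp add: gderiv_def)

text \<open>
  If \<open>g\<close> is a subgradient at \<open>x\<close>, then \<open>f y - g \<bullet> y\<close> is minimal at \<open>x\<close>, so its derivative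
  \<open>grad f x - g\<close> vanishes there.
\<close>

lemma grad_eqI_subgradient:
  fixes f :: "'a::euclidean_space \<Rightarrow> real"
  assumes "f differentiable (at x)" and sub: "\<And>y. f x + g \<bullet> (y - x) \<le> f y"
  shows "grad f x = g"
proof -
  have "((\<lambda>y. f y - y \<bullet> g) has_derivative (\<lambda>h. h \<bullet> grad f x - h \<bullet> g)) (at x)"
    by (intro derivative_intros has_derivative_grad assms(1))
  moreover have "f x - x \<bullet> g \<le> f y - y \<bullet> g" for y
    using sub[of y] by (simp add: inner_diff_right inner_commute)
  ultimately have "(\<lambda>h. h \<bullet> grad f x - h \<bullet> g) = (\<lambda>h. 0)"
    by (intro has_derivative_local_min) auto
  then have "(grad f x - g) \<bullet> (grad f x - g) = 0"
    by (metis inner_diff_right)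
  then show ?thesis by simp
qed

lemma inner_sgn_self: "(x::'a::real_inner) \<bullet> sgn x = norm x"
proof (cases "x = 0")
  case False
  have "x \<bullet> sgn x = (norm x)\<^sup>2 / norm x"
    by (simp add: sgn_div_norm dot_square_norm divide_inverse mult.commute)
  also have "\<dots> = norm x"
    using False by (simp add: power2_eq_square)
  finally show ?thesis .
qed simp
lemma bounded_imageE:
  assumes "bounded (g ` S)"
  obtains B where "\<And>x. x \<in> S \<Longrightarrow> norm (g x) \<le> B"
  using assms unfolding bounded_iff by auto

locale differentiable_convex =
  fixes f :: "'a::euclidean_space \<Rightarrow> real"
  assumes differentiable: "f differentiable (at x)"
    and gradient_inequality: "f x + grad f x \<bullet> (y - x) \<le> f y"
begin

lemma isCont_f: "isCont f x"
  by (rule differentiable_imp_continuous_within[OF differentiable])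

lemma continuous_on_f: "continuous_on S f"
  by (intro continuous_at_imp_continuous_on ballI isCont_f)

text \<open>
  One step of length one in the direction of the gradient raises a convex function by at least the
  norm of the gradient, and \<open>f\<close> is bounded on a ball of radius one larger.
\<close>

lemma bounded_grad:
  assumes "bounded S"
  shows "bounded (grad f ` S)"
proof -
  obtain r where r: "\<And>x. x \<in> S \<Longrightarrow> norm x \<le> r"
    using assms by (auto simp: bounded_iff)
  have "bounded (f ` cball 0 (r + 1))"
    by (intro compact_imp_bounded compact_continuous_image continuous_on_f compact_cball)
  then obtain c where c: "\<And>x. x \<in> cball 0 (r + 1) \<Longrightarrow> norm (f x) \<le> c"
    by (rule bounded_imageE) (rule that)
  have "norm (grad f x) \<le> 2 * c" if "x \<in> S" for x
  proof -
    let ?v = "sgn (grad f x)"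
    have v: "norm ?v \<le> 1" unfolding norm_sgn by simp
    have "norm (grad f x) = grad f x \<bullet> ?v"
      by (rule inner_sgn_self[symmetric])
    also have "\<dots> \<le> f (x + ?v) - f x"
      using gradient_inequality[of x "x + ?v"] by simp
    also have "\<dots> \<le> 2 * c"
    proof -
      have "norm (x + ?v) \<le> r + 1"
        using norm_triangle_ineq[of x ?v] r[OF that] v by linarith
      moreover have "norm x \<le> r + 1" using r[OF that] by simp
      ultimately have "norm (f x) \<le> c" "norm (f (x + ?v)) \<le> c"
        by (simp_all only: c mem_cball_0)
      then show ?thesis unfolding real_norm_def by linarith
    qed
    finally show ?thesis .
  qed
  then show ?thesis by (auto simp: bounded_iff)
qed

text \<open>
  A convex function that is differentiable everywhere has a continuous gradient: the gradient
  inequality passes to limits, so every limit of gradients is a subgradient at the limit point and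
  hence the gradient there.  The graph is thus closed, and boundedness of the gradient on balls
  turns this into continuity.
\<close>

lemma continuous_on_grad: "continuous_on S (grad f)"
proof -
  have "continuous_on (cball 0 r) (grad f)" for r
  proof -
    obtain B where B: "\<And>x. x \<in> cball 0 r \<Longrightarrow> norm (grad f x) \<le> B"
      using bounded_grad[OF bounded_cball, of 0 r]
      by (rule bounded_imageE) (rule that)
    show ?thesis
    proof (rule continuous_from_closed_graph)
      show "compact (cball (0::'a) B)" by simp
      show "grad f \<in> cball 0 r \<rightarrow> cball 0 B" using B by auto
      show "closed ((\<lambda>x. (x, grad f x)) ` cball 0 r)"
        unfolding closed_sequential_limits
      proof (intro allI impI)
        fix s l assume *: "(\<forall>n. s n \<in> (\<lambda>x. (x, grad f x)) ` cball 0 r) \<and> s \<longlonglongrightarrow> l"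
        note mem = conjunct1[OF *, THEN spec] and lim = conjunct2[OF *]
        have s: "fst (s n) \<in> cball 0 r" "snd (s n) = grad f (fst (s n))" for n
          using mem[of n] by (elim imageE, simp)+
        have x: "(\<lambda>n. fst (s n)) \<longlonglongrightarrow> fst l" and g: "(\<lambda>n. snd (s n)) \<longlonglongrightarrow> snd l"
          by (rule tendsto_fst[OF lim], rule tendsto_snd[OF lim])
        have fx: "(\<lambda>n. f (fst (s n))) \<longlonglongrightarrow> f (fst l)"
          by (rule isCont_tendsto_compose[OF isCont_f x])
        have "f (fst l) + snd l \<bullet> (y - fst l) \<le> f y" for y
        proof (rule LIMSEQ_le_const2)
          show "(\<lambda>n. f (fst (s n)) + snd (s n) \<bullet> (y - fst (s n)))
                  \<longlonglongrightarrow> f (fst l) + snd l \<bullet> (y - fst l)"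
            by (intro tendsto_add tendsto_inner tendsto_diff tendsto_const fx g x)
          show "\<exists>N. \<forall>n\<ge>N. f (fst (s n)) + snd (s n) \<bullet> (y - fst (s n)) \<le> f y"
            unfolding s(2) by (simp add: gradient_inequality)
        qed
        then have "grad f (fst l) = snd l"
          by (rule grad_eqI_subgradient[OF differentiable])
        moreover have "fst l \<in> cball 0 r"
          by (rule closed_sequentially[where f = "\<lambda>n. fst (s n)", OF closed_cball s(1) x])
        ultimately show "l \<in> (\<lambda>x. (x, grad f x)) ` cball 0 r"
          by (intro image_eqI[where x = "fst l"]) (simp_all add: prod_eq_iff)
      qed
    qed
  qed
  then have "isCont (grad f) x" for x
    by (rule continuous_on_interior[of "cball 0 (norm x + 1)"]) (simp_all add: interior_cball)
  then show ?thesis by (intro continuous_at_imp_continuous_on ballI)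
qed

end

section \<open>Hamiltonian trajectories\<close>

lemma hamiltonian_solution_iff:
  "hamiltonian_solution f S x y \<longleftrightarrow>
    (\<forall>t\<in>S. ((\<lambda>t. (x t, y t)) has_vector_derivative (y t, - grad f (x t))) (at t within S))"
  (is "_ \<longleftrightarrow> ?r")
proof
  assume "hamiltonian_solution f S x y"
  then show ?r
    by (auto simp: hamiltonian_solution_def intro!: has_vector_derivative_Pair)
next
  assume ?r
  then show "hamiltonian_solution f S x y"
    using bounded_linear.has_vector_derivative[OF bounded_linear_fst]
      bounded_linear.has_vector_derivative[OF bounded_linear_snd]
    unfolding hamiltonian_solution_def by fastforce
qed

lemma hamiltonian_solution_subset:
  assumes "hamiltonian_solution f S x y" "T \<subseteq> S"
  shows "hamiltonian_solution f T x y"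
  using assms unfolding hamiltonian_solution_def
  by (meson has_vector_derivative_within_subset subsetD)

lemma hamiltonian_solution_shift:
  assumes "hamiltonian_solution f ((+) a ` S) x y"
  shows "hamiltonian_solution f S (\<lambda>t. x (a + t)) (\<lambda>t. y (a + t))"
  unfolding hamiltonian_solution_def
proof (intro ballI conjI)
  fix t assume t: "t \<in> S"
  have shift: "((+) a has_vector_derivative 1) (at t within S)"
    by (auto intro!: derivative_eq_intros)
  show "((\<lambda>t. x (a + t)) has_vector_derivative y (a + t)) (at t within S)"
    using vector_diff_chain_within[OF shift, where g = x and g' = "y (a + t)"] assms t
    by (auto simp: hamiltonian_solution_def o_def)
  show "((\<lambda>t. y (a + t)) has_vector_derivative - grad f (x (a + t))) (at t within S)"
    using vector_diff_chain_within[OF shift, where g = y and g' = "- grad f (x (a + t))"] assms t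
    by (auto simp: hamiltonian_solution_def o_def)
qed

text \<open>
  Uniqueness is given only for solutions on all of \<open>{0..}\<close>.  Continuing a solution on \<open>{0..c}\<close>
  by the global solution through its end point makes it available for finite time intervals.
\<close>

lemma hamiltonian_solution_concat:
  assumes c: "0 \<le> c" and 1: "hamiltonian_solution f {0..c} x y"
    and 2: "hamiltonian_solution f {0..} x' y'" and eq: "x' 0 = x c" "y' 0 = y c"
  shows "hamiltonian_solution f {0..} (\<lambda>t. if t \<in> {0..c} then x t else x' (t - c))
           (\<lambda>t. if t \<in> {0..c} then y t else y' (t - c))"
proof -
  have 3: "hamiltonian_solution f {c..} (\<lambda>t. x' (t - c)) (\<lambda>t. y' (t - c))"
  proof -
    have "(+) (- c) ` {c..} = {0..}"
      unfolding image_add_atLeast by simp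
    then have "hamiltonian_solution f ((+) (- c) ` {c..}) x' y'"
      using 2 by (simp only:)
    from hamiltonian_solution_shift[OF this] show ?thesis
      by (simp only: uminus_add_conv_diff)
  qed
  have cl: "closure {0..c} \<inter> closure {c<..} = {c}"
    using c by auto
  have un: "{0..} = {0..c} \<union> {c<..}" "{0..c} \<union> {c} = {0..c}" "{c<..} \<union> {c} = {c..}"
    using c by auto
  have deriv: "((\<lambda>t. if t \<in> {0..c} then u t else u' (t - c)) has_vector_derivative
      (if t \<in> {0..c} then v t else v' (t - c))) (at t within {0..})"
    if t: "t \<in> {0..}"
      and u: "\<And>s. s \<in> {0..c} \<Longrightarrow> (u has_vector_derivative v s) (at s within {0..c})"
      and u': "\<And>s. s \<in> {c..} \<Longrightarrow> ((\<lambda>t. u' (t - c)) has_vector_derivative v' (s - c)) (at s within {c..})"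
      and j: "u' 0 = u c" "v' 0 = v c" for t u u' v v'
  proof (rule has_vector_derivative_If_within_closures)
    show "t \<in> {0..c} \<union> {c<..}" using t by auto
    show "{0..} = {0..c} \<union> {c<..}" by (rule un)
    show "(u has_vector_derivative v t) (at t within {0..c} \<union> closure {0..c} \<inter> closure {c<..})"
      if "t \<in> {0..c} \<union> closure {0..c} \<inter> closure {c<..}"
      using u[of t] that unfolding cl un(2) by simp
    show "((\<lambda>t. u' (t - c)) has_vector_derivative v' (t - c))
        (at t within {c<..} \<union> closure {0..c} \<inter> closure {c<..})"
      if "t \<in> {c<..} \<union> closure {0..c} \<inter> closure {c<..}"
      using u'[of t] that unfolding cl un(3) by simp
    show "u t = u' (t - c)" if "t \<in> closure {0..c}" "t \<in> closure {c<..}"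
      using that j by auto
    show "v t = v' (t - c)" if "t \<in> closure {0..c}" "t \<in> closure {c<..}"
      using that j by auto
  qed
  have d1: "\<And>s. s \<in> {0..c} \<Longrightarrow> (x has_vector_derivative y s) (at s within {0..c})"
    "\<And>s. s \<in> {0..c} \<Longrightarrow> (y has_vector_derivative - grad f (x s)) (at s within {0..c})"
    using 1 by (simp_all add: hamiltonian_solution_def)
  have d2: "\<And>s. s \<in> {c..} \<Longrightarrow> ((\<lambda>t. x' (t - c)) has_vector_derivative y' (s - c)) (at s within {c..})"
    "\<And>s. s \<in> {c..} \<Longrightarrow>
      ((\<lambda>t. y' (t - c)) has_vector_derivative - grad f (x' (s - c))) (at s within {c..})"
    using 3 by (simp_all add: hamiltonian_solution_def)
  have eq': "- grad f (x' 0) = - grad f (x c)" by (simp add: eq)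
  show ?thesis
    unfolding hamiltonian_solution_def
  proof (intro ballI conjI)
    fix t :: real assume t: "t \<in> {0..}"
    show "((\<lambda>t. if t \<in> {0..c} then x t else x' (t - c)) has_vector_derivative
         (if t \<in> {0..c} then y t else y' (t - c))) (at t within {0..})"
      by (rule deriv[of t x y x' y', OF t d1(1) d2(1) eq])
    have "- grad f (if t \<in> {0..c} then x t else x' (t - c)) =
        (if t \<in> {0..c} then - grad f (x t) else - grad f (x' (t - c)))"
      by auto
    then show "((\<lambda>t. if t \<in> {0..c} then y t else y' (t - c)) has_vector_derivative
         - grad f (if t \<in> {0..c} then x t else x' (t - c))) (at t within {0..})"
      using deriv[of t y "\<lambda>t. - grad f (x t)" y' "\<lambda>t. - grad f (x' t)", OF t d1(2) d2(2) eq(2) eq']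
      by (simp only:)
  qed
qed

text \<open>
  A mean value inequality with one-sided derivatives at the left end point, which is the kind of
  derivative that a solution on \<open>{0..}\<close> has at time \<open>0\<close>.
\<close>

lemma real_increment_le:
  fixes g g' :: "real \<Rightarrow> real"
  assumes "0 \<le> h"
    and deriv: "\<And>s. \<lbrakk>0 \<le> s; s \<le> h\<rbrakk> \<Longrightarrow> (g has_real_derivative g' s) (at s within {0..})"
    and bound: "\<And>s. \<lbrakk>0 \<le> s; s \<le> h\<rbrakk> \<Longrightarrow> g' s \<le> B"
  shows "g h \<le> g 0 + B * h"
proof (cases "h = 0")
  case False
  with \<open>0 \<le> h\<close> have h: "0 < h" by simp
  have "\<exists>s\<in>{0<..<h}. g h - g 0 = g' s * (h - 0)"
  proof (rule mvt_simple[OF h])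
    show "(g has_derivative (*) (g' s)) (at s within {0..h})" if "0 \<le> s" "s \<le> h" for s
      using has_field_derivative_subset[OF deriv[OF that], of "{0..h}"]
      by (simp add: has_field_derivative_def subset_iff)
  qed
  then obtain s where "0 < s" "s < h" "g h - g 0 = g' s * h" by auto
  then show ?thesis
    using mult_right_mono[OF bound[of s] \<open>0 \<le> h\<close>] by linarith
qed simp

section \<open>The Hamiltonian flow and its continuity\<close>

text \<open>
  Solutions are total functions, unique only at times \<open>t \<ge> 0\<close>; the values at negative times
  are arbitrary.
\<close>

definition flow :: "('a::euclidean_space \<Rightarrow> real) \<Rightarrow> real \<Rightarrow> 'a \<times> 'a \<Rightarrow> 'a \<times> 'a" where
  "flow f t z =
    (SOME p. hamiltonian_solution f {0..} (\<lambda>s. fst (p s)) (\<lambda>s. snd (p s)) \<and> p 0 = z) t"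

definition ham_field :: "('a::euclidean_space \<Rightarrow> real) \<Rightarrow> 'a \<times> 'a \<Rightarrow> 'a \<times> 'a" where
  "ham_field f z = (snd z, - grad f (fst z))"

text \<open>
  The conserved Hamiltonian.
\<close>

definition energy :: "('a::euclidean_space \<Rightarrow> real) \<Rightarrow> 'a \<times> 'a \<Rightarrow> real" where
  "energy f z = f (fst z) + (norm (snd z))\<^sup>2 / 2"

locale strongly_convex_flow =
  fixes f :: "'a::euclidean_space \<Rightarrow> real" and \<alpha> :: real and xstar :: 'a
  assumes alpha_pos: "0 < \<alpha>"
    and f_differentiable: "f differentiable (at x)"
    and f_strongly_convex: "strongly_convex \<alpha> f"
    and minimizer: "f xstar \<le> f x"
    and well_defined: "hamiltonian_flow_well_defined f"
begin

lemma strong_convexity: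
  "f x + grad f x \<bullet> (y - x) + \<alpha> / 2 * (norm (y - x))\<^sup>2 \<le> f y"
  using f_strongly_convex by (simp add: strongly_convex_def)

sublocale differentiable_convex f
proof
  show "f x + grad f x \<bullet> (y - x) \<le> f y" for x y
    using strong_convexity[of x y] alpha_pos
    by (smt (verit) divide_nonneg_pos mult_nonneg_nonneg zero_le_power2)
qed (rule f_differentiable)

lemma quadratic_growth: "\<alpha> / 2 * (norm (x - xstar))\<^sup>2 \<le> f x - f xstar"
proof -
  have "grad f xstar = 0"
    by (rule grad_eqI_subgradient[OF f_differentiable]) (simp add: minimizer)
  then show ?thesis
    using strong_convexity[of xstar x] by simp
qed

lemma flow_solution:
  "hamiltonian_solution f {0..} (\<lambda>s. fst (flow f s z)) (\<lambda>s. snd (flow f s z))"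
  and flow_0 [simp]: "flow f 0 z = z"
proof -
  obtain x y where "hamiltonian_solution f {0..} x y" "x 0 = fst z" "y 0 = snd z"
    using well_defined unfolding hamiltonian_flow_well_defined_def by blast
  then have "\<exists>p. hamiltonian_solution f {0..} (\<lambda>s. fst (p s)) (\<lambda>s. snd (p s)) \<and> p 0 = z"
    by (intro exI[of _ "\<lambda>s. (x s, y s)"]) simp
  from someI_ex[OF this]
  show "hamiltonian_solution f {0..} (\<lambda>s. fst (flow f s z)) (\<lambda>s. snd (flow f s z))"
    and "flow f 0 z = z"
    by (simp_all add: flow_def)
qed

lemma global_solution_eq_flow:
  assumes "hamiltonian_solution f {0..} x y" "0 \<le> t"
  shows "(x t, y t) = flow f t (x 0, y 0)"
proof -
  let ?p = "\<lambda>s. flow f s (x 0, y 0)"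
  have "hamiltonian_solution f {0..} (\<lambda>s. fst (?p s)) (\<lambda>s. snd (?p s))"
    "fst (?p 0) = x 0" "snd (?p 0) = y 0"
    using flow_solution by simp_all
  then have "x t = fst (?p t) \<and> y t = snd (?p t)"
    using well_defined[unfolded hamiltonian_flow_well_defined_def, THEN spec, THEN spec,
        THEN conjunct2, THEN spec[of _ x], THEN spec[of _ y],
        THEN spec[of _ "\<lambda>s. fst (?p s)"], THEN spec[of _ "\<lambda>s. snd (?p s)"]] assms
    by blast
  then show ?thesis by (simp add: prod_eq_iff)
qed

text \<open>
  Local uniqueness, by extending the solution beyond \<open>c\<close>.
\<close>

lemma solution_eq_flow:
  assumes "hamiltonian_solution f {0..c} x y" and t: "0 \<le> t" "t \<le> c"
  shows "(x t, y t) = flow f t (x 0, y 0)"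
proof -
  let ?w = "\<lambda>s. flow f s (x c, y c)"
  let ?x = "\<lambda>t. if t \<in> {0..c} then x t else fst (?w (t - c))"
  let ?y = "\<lambda>t. if t \<in> {0..c} then y t else snd (?w (t - c))"
  have "hamiltonian_solution f {0..} ?x ?y"
    using t by (intro hamiltonian_solution_concat[OF _ assms(1) flow_solution]) simp_all
  moreover have "?x 0 = x 0" "?y 0 = y 0" using t by simp_all
  ultimately have "(?x t, ?y t) = flow f t (x 0, y 0)"
    using global_solution_eq_flow[of ?x ?y t] \<open>0 \<le> t\<close> by simp
  then show ?thesis using t by (simp add: prod_eq_iff)
qed

lemma flow_has_vector_derivative:
  assumes "0 \<le> t"
  shows "((\<lambda>s. flow f s z) has_vector_derivative ham_field f (flow f t z)) (at t within {0..})"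
  using flow_solution[of z] assms by (simp add: hamiltonian_solution_iff ham_field_def)

lemma position_has_vector_derivative:
  assumes "0 \<le> t"
  shows "((\<lambda>s. fst (flow f s z)) has_vector_derivative snd (flow f t z)) (at t within {0..})"
  using flow_solution[of z] assms by (simp add: hamiltonian_solution_def)

lemma velocity_has_vector_derivative:
  assumes "0 \<le> t"
  shows "((\<lambda>s. snd (flow f s z)) has_vector_derivative - grad f (fst (flow f t z))) (at t within {0..})"
  using flow_solution[of z] assms by (simp add: hamiltonian_solution_def)

lemma potential_has_real_derivative:
  assumes "0 \<le> t"
  shows "((\<lambda>s. f (fst (flow f s z))) has_real_derivative
    snd (flow f t z) \<bullet> grad f (fst (flow f t z))) (at t within {0..})"
  using has_derivative_compose[OF
      position_has_vector_derivative[OF assms, of z, unfolded has_vector_derivative_def]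
      has_derivative_grad[OF f_differentiable]]
  by (simp add: has_field_derivative_def mult_commute_abs)

lemma kinetic_has_real_derivative:
  assumes "0 \<le> t"
  shows "((\<lambda>s. (norm (snd (flow f s z)))\<^sup>2) has_real_derivative
    - 2 * (snd (flow f t z) \<bullet> grad f (fst (flow f t z)))) (at t within {0..})"
proof -
  note v = velocity_has_vector_derivative[OF assms, of z, unfolded has_vector_derivative_def]
  show ?thesis
    unfolding power2_norm_eq_inner has_field_derivative_def
    by (rule has_derivative_eq_rhs[OF has_derivative_inner[OF v v]])
      (simp add: fun_eq_iff inner_commute)
qed

text \<open>
  Energy is in fact conserved; the inequality is the half that keeps trajectories, also after
  velocity resets, inside one energy sublevel set.  By strong convexity that set is compact
  (\<open>compact_sublevel\<close>), which yields every uniform bound below.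
\<close>

lemma energy_flow_le:
  assumes "0 \<le> t"
  shows "energy f (flow f t z) \<le> energy f z"
proof -
  have "energy f (flow f t z) \<le> energy f (flow f 0 z) + 0 * t"
    unfolding energy_def
  proof (rule real_increment_le[OF assms])
    show "((\<lambda>s. f (fst (flow f s z)) + (norm (snd (flow f s z)))\<^sup>2 / 2) has_real_derivative
        snd (flow f s z) \<bullet> grad f (fst (flow f s z))
        + - 2 * (snd (flow f s z) \<bullet> grad f (fst (flow f s z))) / 2) (at s within {0..})"
      if "0 \<le> s" for s
      by (rule DERIV_add[OF potential_has_real_derivative[OF that]
            DERIV_cdivide[OF kinetic_has_real_derivative[OF that]]])
  qed simp
  then show ?thesis by simp
qed

abbreviation sublevel :: "real \<Rightarrow> ('a \<times> 'a) set" where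
  "sublevel c \<equiv> {z. energy f z \<le> c}"

lemma flow_in_sublevel: "\<lbrakk>0 \<le> t; z \<in> sublevel c\<rbrakk> \<Longrightarrow> flow f t z \<in> sublevel c"
  using energy_flow_le[of t z] by simp

lemma continuous_on_energy: "continuous_on S (energy f)"
  unfolding energy_def[abs_def]
  by (intro continuous_intros continuous_on_compose2[OF continuous_on_f[of UNIV]]) auto

lemma compact_sublevel: "compact (sublevel c)"
  unfolding compact_eq_bounded_closed
proof
  show "closed (sublevel c)"
    using closed_Collect_le[OF continuous_on_energy continuous_on_const] .
  let ?r = "sqrt (2 / \<alpha> * (c - f xstar))" and ?s = "sqrt (2 * (c - f xstar))"
  have "norm (fst z - xstar) \<le> ?r \<and> norm (snd z) \<le> ?s" if "energy f z \<le> c" for z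
  proof
    have "\<alpha> / 2 * (norm (fst z - xstar))\<^sup>2 \<le> c - f xstar"
      using quadratic_growth[of "fst z"] that unfolding energy_def
      by (smt (verit) divide_nonneg_pos zero_le_power2)
    then show "norm (fst z - xstar) \<le> ?r"
      using alpha_pos by (intro real_le_rsqrt) (simp add: field_simps)
    show "norm (snd z) \<le> ?s"
      using that minimizer[of "fst z"] unfolding energy_def by (intro real_le_rsqrt) simp
  qed
  then have "sublevel c \<subseteq> cball xstar ?r \<times> cball 0 ?s"
    by (auto simp: dist_norm norm_minus_commute)
  then show "bounded (sublevel c)"
    by (rule bounded_subset[OF bounded_Times[OF bounded_cball bounded_cball]])
qed

lemma continuous_on_ham_field: "continuous_on S (ham_field f)"
  unfolding ham_field_def[abs_def]
  by (intro continuous_intros continuous_on_compose2[OF continuous_on_grad[of UNIV]]) auto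

lemma flow_lipschitz_in_time:
  obtains B where "0 \<le> B"
    "\<And>s t z. \<lbrakk>0 \<le> s; 0 \<le> t; z \<in> sublevel c\<rbrakk>
      \<Longrightarrow> norm (flow f s z - flow f t z) \<le> B * \<bar>s - t\<bar>"
proof -
  have "bounded (ham_field f ` sublevel c)"
    by (intro compact_imp_bounded compact_continuous_image continuous_on_ham_field compact_sublevel)
  then obtain B where B: "\<And>z. z \<in> sublevel c \<Longrightarrow> norm (ham_field f z) \<le> B"
    by (rule bounded_imageE) (rule that)
  show thesis
  proof
    fix s t :: real and z assume st: "0 \<le> s" "0 \<le> t" and z: "z \<in> sublevel c"
    have "norm (flow f s z - flow f t z) \<le> max 0 B * norm (s - t)"
    proof (rule differentiable_bound[where S = "{0..}"])
      show "((\<lambda>s. flow f s z) has_derivative (\<lambda>h. h *\<^sub>R ham_field f (flow f r z)))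
          (at r within {0..})" if "r \<in> {0..}" for r
        using flow_has_vector_derivative[of r z] that by (simp add: has_vector_derivative_def)
      show "onorm (\<lambda>h. h *\<^sub>R ham_field f (flow f r z)) \<le> max 0 B" if "r \<in> {0..}" for r
      proof (rule onorm_le)
        have "norm (ham_field f (flow f r z)) \<le> max 0 B"
          using B[OF flow_in_sublevel[of r z c]] that z by auto
        then have "\<bar>h\<bar> * norm (ham_field f (flow f r z)) \<le> \<bar>h\<bar> * max 0 B" for h :: real
          by (rule mult_left_mono) simp
        then show "norm (h *\<^sub>R ham_field f (flow f r z)) \<le> max 0 B * norm h" for h :: real
          by (simp only: norm_scaleR real_norm_def mult.commute[of "max 0 B"])
      qed
    qed (use st in auto)
    then show "norm (flow f s z - flow f t z) \<le> max 0 B * \<bar>s - t\<bar>" by simp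
  qed simp
qed

text \<open>
  Continuous dependence on the initial state.  The gradient need not be Lipschitz, so there is no
  Gronwall estimate; uniqueness of solutions does the work.  On a sublevel set the trajectories are
  uniformly bounded and equi-Lipschitz, so by the Arzela-Ascoli theorem a convergent sequence of
  initial states has a subsequence of trajectories that converges uniformly.  The derivatives
  converge uniformly as well, so the limit solves the system and must be the trajectory of the
  limiting state.  The graph of the flow map is therefore closed in a compact set.
\<close>

lemma flow_continuous_on_sublevel:
  assumes s: "0 \<le> s"
  shows "continuous_on (sublevel c) (flow f s)"
proof (rule continuous_from_closed_graph[OF compact_sublevel])
  show "flow f s \<in> sublevel c \<rightarrow> sublevel c"
    using flow_in_sublevel[OF s] by auto
  obtain B where B: "0 \<le> B" "\<And>s t z. \<lbrakk>0 \<le> s; 0 \<le> t; z \<in> sublevel c\<rbrakk>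
      \<Longrightarrow> norm (flow f s z - flow f t z) \<le> B * \<bar>s - t\<bar>"
    using flow_lipschitz_in_time by blast
  obtain b where b: "\<And>z. z \<in> sublevel c \<Longrightarrow> norm z \<le> b"
    using compact_imp_bounded[OF compact_sublevel[of c]] bounded_iff by meson
  show "closed ((\<lambda>z. (z, flow f s z)) ` sublevel c)"
    unfolding closed_sequential_limits
  proof (intro allI impI)
    fix w l assume w: "(\<forall>n. w n \<in> (\<lambda>z. (z, flow f s z)) ` sublevel c) \<and> w \<longlonglongrightarrow> l"
    define z where "z = (\<lambda>n. fst (w n))"
    have z: "z n \<in> sublevel c" and w_eq: "w n = (z n, flow f s (z n))" for n
    proof -
      have "w n \<in> (\<lambda>z. (z, flow f s z)) ` sublevel c" using w by simp
      then show "z n \<in> sublevel c" "w n = (z n, flow f s (z n))" by (auto simp: z_def)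
    qed
    have z_lim: "z \<longlonglongrightarrow> fst l" and flow_lim: "(\<lambda>n. flow f s (z n)) \<longlonglongrightarrow> snd l"
      using w tendsto_fst[of w l] tendsto_snd[of w l] by (auto simp: w_eq)
    have zl: "fst l \<in> sublevel c"
      using closed_sequentially[OF compact_imp_closed[OF compact_sublevel] z z_lim] .
    obtain p k where p: "continuous_on {0..s} p" and k: "strict_mono (k :: nat \<Rightarrow> nat)"
      and unif: "\<And>e. 0 < e \<Longrightarrow> \<exists>N. \<forall>n r. n \<ge> N \<and> r \<in> {0..s}
        \<longrightarrow> norm (flow f r (z (k n)) - p r) < e"
    proof (rule Arzela_Ascoli[of "{0..s}" "\<lambda>n r. flow f r (z n)" b])
      show "norm (flow f r (z n)) \<le> b" if "r \<in> {0..s}" for n r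
        using that z[of n] flow_in_sublevel[of r] by (intro b) auto
      (* B + 1 rather than B, because B may be 0. *)
      show "\<exists>d>0. \<forall>n r'. r' \<in> {0..s} \<and> norm (r - r') < d
          \<longrightarrow> norm (flow f r (z n) - flow f r' (z n)) < e" if "r \<in> {0..s}" "0 < e" for r e
      proof (intro exI[of _ "e / (B + 1)"] conjI allI impI)
        show "0 < e / (B + 1)" using \<open>0 < e\<close> B(1) by simp
        fix n r' assume r': "r' \<in> {0..s} \<and> norm (r - r') < e / (B + 1)"
        have "norm (flow f r (z n) - flow f r' (z n)) \<le> B * \<bar>r - r'\<bar>"
          using B(2) z r' that by simp
        also have "\<dots> \<le> (B + 1) * \<bar>r - r'\<bar>" by (simp add: mult_right_mono)
        also have "\<dots> < e" using r' B(1) by (simp add: field_simps)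
        finally show "norm (flow f r (z n) - flow f r' (z n)) < e" .
      qed
    qed (use that in auto)
    have p_lim: "(\<lambda>n. flow f r (z (k n))) \<longlonglongrightarrow> p r" if "r \<in> {0..s}" for r
      unfolding LIMSEQ_iff using unif that by blast
    have p_in: "p r \<in> sublevel c" if "r \<in> {0..s}" for r
      using that z flow_in_sublevel
      by (intro closed_sequentially[OF compact_imp_closed[OF compact_sublevel] _ p_lim[OF that]]) auto
    have unif_field: "\<forall>\<^sub>F n in sequentially. \<forall>r\<in>{0..s}.
        \<forall>h. norm (h *\<^sub>R ham_field f (flow f r (z (k n))) - h *\<^sub>R ham_field f (p r)) \<le> e * norm h"
      if "0 < e" for e
    proof -
      obtain d where d: "0 < d"
        "\<And>v v'. \<lbrakk>v \<in> sublevel c; v' \<in> sublevel c; dist v' v < d\<rbrakk>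
          \<Longrightarrow> dist (ham_field f v') (ham_field f v) < e"
        by (rule uniformly_continuous_onE[OF compact_uniformly_continuous[OF
                continuous_on_ham_field compact_sublevel[of c]] \<open>0 < e\<close>]) (rule that)
      obtain N where N: "\<And>n r. \<lbrakk>n \<ge> N; r \<in> {0..s}\<rbrakk> \<Longrightarrow> norm (flow f r (z (k n)) - p r) < d"
        using unif[OF d(1)] by blast
      have "norm (h *\<^sub>R ham_field f (flow f r (z (k n))) - h *\<^sub>R ham_field f (p r)) \<le> e * norm h"
        if "n \<ge> N" "r \<in> {0..s}" for n r and h :: real
      proof -
        have "dist (ham_field f (flow f r (z (k n)))) (ham_field f (p r)) < e"
          using that N p_in z flow_in_sublevel by (intro d(2)) (auto simp: dist_norm)
        then have "\<bar>h\<bar> * norm (ham_field f (flow f r (z (k n))) - ham_field f (p r)) \<le> \<bar>h\<bar> * e"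
          by (intro mult_left_mono) (auto simp: dist_norm)
        then show ?thesis
          by (simp add: mult.commute flip: scaleR_diff_right)
      qed
      then show ?thesis
        unfolding eventually_sequentially by (intro exI[of _ N] allI impI ballI)
    qed
    have "\<exists>g. \<forall>r\<in>{0..s}. (\<lambda>n. flow f r (z (k n))) \<longlonglongrightarrow> g r \<and>
        (g has_derivative (\<lambda>h. h *\<^sub>R ham_field f (p r))) (at r within {0..s})"
    proof (rule has_derivative_sequence[where
          f' = "\<lambda>n r h. h *\<^sub>R ham_field f (flow f r (z (k n)))", OF _ _ unif_field])
      show "((\<lambda>r. flow f r (z (k n))) has_derivative (\<lambda>h. h *\<^sub>R ham_field f (flow f r (z (k n)))))
          (at r within {0..s})" if "r \<in> {0..s}" for n r
        using has_vector_derivative_within_subset[OF flow_has_vector_derivative[of r "z (k n)"], of "{0..s}"] that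
        by (auto simp: has_vector_derivative_def)
      show "(\<lambda>n. flow f 0 (z (k n))) \<longlonglongrightarrow> p 0"
        by (rule p_lim) (use s in simp)
    qed (use s in auto)
    then obtain g where g: "\<And>r. r \<in> {0..s} \<Longrightarrow> (\<lambda>n. flow f r (z (k n))) \<longlonglongrightarrow> g r"
      "\<And>r. r \<in> {0..s} \<Longrightarrow> (g has_vector_derivative ham_field f (p r)) (at r within {0..s})"
      unfolding has_vector_derivative_def by blast
    have gp: "g r = p r" if "r \<in> {0..s}" for r
      using LIMSEQ_unique g(1) p_lim that by blast
    have "hamiltonian_solution f {0..s} (\<lambda>r. fst (g r)) (\<lambda>r. snd (g r))"
      unfolding hamiltonian_solution_iff using g(2) gp by (auto simp: ham_field_def)
    then have "g s = flow f s (g 0)"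
      using solution_eq_flow[of s "\<lambda>r. fst (g r)" "\<lambda>r. snd (g r)" s] s by simp
    moreover have "g s = snd l"
      using LIMSEQ_unique[OF g(1)[of s]] LIMSEQ_subseq_LIMSEQ[OF flow_lim k] s by (auto simp: o_def)
    moreover have "g 0 = fst l"
      using LIMSEQ_unique[OF g(1)[of 0]] LIMSEQ_subseq_LIMSEQ[OF z_lim k] s by (auto simp: o_def)
    ultimately have "l = (fst l, flow f s (fst l))" by (simp add: prod_eq_iff)
    then show "l \<in> (\<lambda>z. (z, flow f s z)) ` sublevel c" using zl by blast
  qed
qed

lemma flow_jointly_continuous:
  assumes s: "\<And>n. 0 \<le> s n" "s \<longlonglongrightarrow> s'" and z: "\<And>n. z n \<in> sublevel c" "z \<longlonglongrightarrow> z'"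
  shows "(\<lambda>n. flow f (s n) (z n)) \<longlonglongrightarrow> flow f s' z'"
proof -
  obtain B where B: "0 \<le> B" "\<And>s t z. \<lbrakk>0 \<le> s; 0 \<le> t; z \<in> sublevel c\<rbrakk>
      \<Longrightarrow> norm (flow f s z - flow f t z) \<le> B * \<bar>s - t\<bar>"
    using flow_lipschitz_in_time by blast
  have s': "0 \<le> s'" using LIMSEQ_le_const[OF s(2)] s(1) by blast
  have z': "z' \<in> sublevel c"
    using closed_sequentially[OF compact_imp_closed[OF compact_sublevel] z] .
  have "(\<lambda>n. flow f (s n) (z n) - flow f s' (z n)) \<longlonglongrightarrow> 0"
  proof (rule Lim_null_comparison)
    show "\<forall>\<^sub>F n in sequentially. norm (flow f (s n) (z n) - flow f s' (z n)) \<le> B * \<bar>s n - s'\<bar>"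
      using B(2) s(1) s' z(1) by simp
    show "(\<lambda>n. B * \<bar>s n - s'\<bar>) \<longlonglongrightarrow> 0"
      by (intro tendsto_mult_right_zero tendsto_rabs_zero LIM_zero s)
  qed
  moreover have "(\<lambda>n. flow f s' (z n)) \<longlonglongrightarrow> flow f s' z'"
    using continuous_on_tendsto_compose[OF flow_continuous_on_sublevel[OF s'] z(2) z'] z(1) by simp
  ultimately show ?thesis
    using tendsto_add by fastforce
qed

end

section \<open>The Lyapunov function and its drift\<close>

text \<open>
  The expansion of the square that is completed in the drift estimate.
\<close>

lemma norm_add_scaleR_squared:
  fixes y u :: "'a::real_inner"
  shows "(norm (y + c *\<^sub>R u))\<^sup>2 = (norm y)\<^sup>2 + 2 * c * (y \<bullet> u) + c\<^sup>2 * (norm u)\<^sup>2"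
  unfolding power2_norm_eq_inner
  by (simp add: inner_add_left inner_add_right inner_commute power2_eq_square)

text \<open>
  The jump of the process at an event: the velocity is reset.
\<close>

definition refresh :: "'a::zero \<times> 'a \<Rightarrow> 'a \<times> 'a" where
  "refresh z = (fst z, 0)"

lemma fst_refresh [simp]: "fst (refresh z) = fst z"
  and snd_refresh [simp]: "snd (refresh z) = 0"
  by (simp_all add: refresh_def)

context strongly_convex_flow
begin

text \<open>
  The decay rate.  The refreshment rate \<open>sqrt (16 * \<alpha> / 5)\<close> is \<open>4 * lam\<close>.
\<close>

definition lam :: real where "lam = sqrt (\<alpha> / 5)"

text \<open>
  At zero velocity the last term is \<open>\<alpha> / 10 * (norm (x - xstar))\<^sup>2\<close>, the one in the claimed bound.
\<close>

definition lyapunov :: "'a \<times> 'a \<Rightarrow> real" where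
  "lyapunov z = f (fst z) - f xstar + (norm (snd z + lam *\<^sub>R (fst z - xstar)))\<^sup>2 / 2"

text \<open>
  The part of the Lyapunov function that a refreshment removes; see \<open>lyapunov_eq_refresh_cross\<close>.
  The two definitions after it are the derivatives along the flow of the remaining part and of
  this part.
\<close>

definition cross :: "'a \<times> 'a \<Rightarrow> real" where
  "cross z = (norm (snd z))\<^sup>2 / 2 + lam * (snd z \<bullet> (fst z - xstar))"

definition refreshed_drift :: "'a \<times> 'a \<Rightarrow> real" where
  "refreshed_drift z = snd z \<bullet> grad f (fst z) + lam\<^sup>2 * (snd z \<bullet> (fst z - xstar))"

definition cross_drift :: "'a \<times> 'a \<Rightarrow> real" where
  "cross_drift z = lam * ((norm (snd z))\<^sup>2 - grad f (fst z) \<bullet> (fst z - xstar))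
    - snd z \<bullet> grad f (fst z)"

lemma lam_pos: "0 < lam"
  using alpha_pos by (simp add: lam_def)

lemma lam_squared: "lam\<^sup>2 = \<alpha> / 5"
  using alpha_pos by (simp add: lam_def)

lemma lyapunov_refresh:
  "lyapunov (refresh z) = f (fst z) - f xstar + lam\<^sup>2 / 2 * (norm (fst z - xstar))\<^sup>2"
  by (simp add: lyapunov_def power_mult_distrib)

lemma lyapunov_eq_refresh_cross: "lyapunov z = lyapunov (refresh z) + cross z"
  unfolding lyapunov_refresh lyapunov_def cross_def norm_add_scaleR_squared
  by (simp add: add_divide_distrib)

lemma suboptimality_le_lyapunov: "f (fst z) - f xstar \<le> lyapunov z"
  by (simp add: lyapunov_def)

text \<open>
  The infinitesimal generator of the refreshed process, applied to the Lyapunov function, is at most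
  \<open>- lam\<close> times that function; \<open>- 4 * lam * cross z\<close> is the contribution of the jumps.  Strong
  convexity between \<open>x\<close> and \<open>xstar\<close> bounds \<open>f x - f xstar - grad f x \<bullet> u\<close>, where
  \<open>u = x - xstar\<close>, and what is left is
  \<open>- lam / 2 * (norm (y + 2 * lam * u))\<^sup>2\<close>.  It is exactly a square
  because the refreshment rate is four times \<open>lam\<close> and \<open>\<alpha> = 5 * lam\<^sup>2\<close>.
\<close>

lemma drift_nonpos:
  "lam * lyapunov z + (refreshed_drift z + cross_drift z) - 4 * lam * cross z \<le> 0"
proof -
  define u y where "u = fst z - xstar" and "y = snd z"
  define a g where "a = f (fst z) - f xstar" and "g = grad f (fst z)"
  have "a \<le> g \<bullet> u - \<alpha> / 2 * (norm u)\<^sup>2"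
    using strong_convexity[of "fst z" xstar] unfolding a_def g_def u_def
    by (simp add: norm_minus_commute inner_diff_right)
  then have "a - g \<bullet> u + 5 / 2 * lam\<^sup>2 * (norm u)\<^sup>2 \<le> 0"
    by (simp add: lam_squared)
  then have convex: "lam * (a - g \<bullet> u + 5 / 2 * lam\<^sup>2 * (norm u)\<^sup>2) \<le> 0"
    using lam_pos by (intro mult_nonneg_nonpos) simp_all
  have "lam * lyapunov z + (refreshed_drift z + cross_drift z) - 4 * lam * cross z
      = lam * (a + lam\<^sup>2 / 2 * (norm u)\<^sup>2 + ((norm y)\<^sup>2 / 2 + lam * (y \<bullet> u)))
        + (y \<bullet> g + lam\<^sup>2 * (y \<bullet> u) + (lam * ((norm y)\<^sup>2 - g \<bullet> u) - y \<bullet> g))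
        - 4 * lam * ((norm y)\<^sup>2 / 2 + lam * (y \<bullet> u))"
    unfolding lyapunov_eq_refresh_cross[of z] lyapunov_refresh refreshed_drift_def
      cross_drift_def cross_def u_def y_def a_def g_def ..
  also have "\<dots> = lam * (a - g \<bullet> u + 5 / 2 * lam\<^sup>2 * (norm u)\<^sup>2)
      - lam / 2 * ((norm y)\<^sup>2 + 2 * (2 * lam) * (y \<bullet> u) + (2 * lam)\<^sup>2 * (norm u)\<^sup>2)"
    by (simp add: field_simps power2_eq_square)
  also have "\<dots> \<le> 0"
    using convex lam_pos unfolding norm_add_scaleR_squared[symmetric]
    by (smt (verit) divide_pos_pos mult_nonneg_nonneg zero_le_power2)
  finally show ?thesis .
qed

lemma displacement_has_vector_derivative:
  assumes "0 \<le> t"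
  shows "((\<lambda>s. fst (flow f s z) - xstar) has_vector_derivative snd (flow f t z))
    (at t within {0..})"
  using has_vector_derivative_diff[OF position_has_vector_derivative[OF assms, of z]
      has_vector_derivative_const[of xstar]]
  by simp

lemma lyapunov_refresh_flow_deriv:
  assumes "0 \<le> t"
  shows "((\<lambda>s. lyapunov (refresh (flow f s z))) has_real_derivative
    refreshed_drift (flow f t z)) (at t within {0..})"
proof -
  note u = displacement_has_vector_derivative[OF assms, of z, unfolded has_vector_derivative_def]
  have "((\<lambda>s. (norm (fst (flow f s z) - xstar))\<^sup>2) has_real_derivative
      2 * (snd (flow f t z) \<bullet> (fst (flow f t z) - xstar))) (at t within {0..})"
    unfolding power2_norm_eq_inner has_field_derivative_def
    by (rule has_derivative_eq_rhs[OF has_derivative_inner[OF u u]])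
      (simp add: fun_eq_iff inner_commute)
  from DERIV_add[OF DERIV_diff[OF potential_has_real_derivative[OF assms, of z] DERIV_const]
      DERIV_cmult[OF this, of "lam\<^sup>2 / 2"], of "f xstar"]
  show ?thesis
    unfolding lyapunov_refresh refreshed_drift_def by simp
qed

lemma cross_flow_deriv:
  assumes "0 \<le> t"
  shows "((\<lambda>s. cross (flow f s z)) has_real_derivative cross_drift (flow f t z))
    (at t within {0..})"
proof -
  note u = displacement_has_vector_derivative[OF assms, of z, unfolded has_vector_derivative_def]
  note v = velocity_has_vector_derivative[OF assms, of z, unfolded has_vector_derivative_def]
  have "((\<lambda>s. snd (flow f s z) \<bullet> (fst (flow f s z) - xstar)) has_real_derivative
      (norm (snd (flow f t z)))\<^sup>2 - grad f (fst (flow f t z)) \<bullet> (fst (flow f t z) - xstar))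
      (at t within {0..})"
    unfolding power2_norm_eq_inner has_field_derivative_def
    by (rule has_derivative_eq_rhs[OF has_derivative_inner[OF v u]])
      (simp add: fun_eq_iff algebra_simps)
  from DERIV_add[OF DERIV_cdivide[OF kinetic_has_real_derivative[OF assms, of z], of 2]
      DERIV_cmult[OF this, of lam]]
  show ?thesis
    unfolding cross_def cross_drift_def by (simp add: add.commute)
qed

lemma continuous_on_lyapunov: "continuous_on S lyapunov"
  unfolding lyapunov_def[abs_def]
  by (intro continuous_intros continuous_on_compose2[OF continuous_on_f[of UNIV]]) auto

lemma continuous_on_refreshed_rate:
  "continuous_on S (\<lambda>z. lam * lyapunov (refresh z) + refreshed_drift z)"
  unfolding lyapunov_refresh refreshed_drift_def
  by (intro continuous_intros continuous_on_compose2[OF continuous_on_f[of UNIV]]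
      continuous_on_compose2[OF continuous_on_grad[of UNIV]]) auto

text \<open>
  Flowing for a time \<open>h\<close> and then refreshing with the probability \<open>1 - exp (- (4 * lam * h))\<close> of an
  event in that time lets the Lyapunov function decay at rate \<open>lam\<close> in expectation, up to an error
  of second order.  Refreshing only at the end of the step makes the drift estimate available with
  the weight \<open>q = exp (- (4 * lam * s))\<close> instead of \<open>1\<close>.  The missing weight \<open>1 - q\<close> is
  \<open>O(s)\<close>, and it multiplies a continuous function of the state, bounded on the sublevel set.
\<close>

lemma one_step_contraction:
  obtains C where "0 \<le> C"
    "\<And>h z. \<lbrakk>0 \<le> h; h \<le> T; z \<in> sublevel c\<rbrakk> \<Longrightarrow>
      lyapunov (refresh (flow f h z)) + exp (- (4 * lam * h)) * cross (flow f h z)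
        \<le> exp (- (lam * h)) * lyapunov z + C * h\<^sup>2"
proof -
  have "bounded ((\<lambda>z. lam * lyapunov (refresh z) + refreshed_drift z) ` sublevel c)"
    by (intro compact_imp_bounded compact_continuous_image continuous_on_refreshed_rate
        compact_sublevel)
  then obtain K where K: "\<And>z. z \<in> sublevel c \<Longrightarrow>
      norm (lam * lyapunov (refresh z) + refreshed_drift z) \<le> K"
    by (rule bounded_imageE) (rule that)
  define K' where "K' = max 0 K"
  have K': "0 \<le> K'" "\<And>z. z \<in> sublevel c \<Longrightarrow> lam * lyapunov (refresh z) + refreshed_drift z \<le> K'"
    using K by (force simp: K'_def)+
  let ?C = "exp (lam * T) * (4 * lam) * K'"
  show thesis
  proof (rule that[of ?C])
    show "0 \<le> ?C" using K'(1) lam_pos by simp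
    fix h z assume h: "0 \<le> h" "h \<le> T" and z: "z \<in> sublevel c"
    let ?V = "\<lambda>s. lyapunov (refresh (flow f s z))" and ?W = "\<lambda>s. cross (flow f s z)"
    let ?V' = "\<lambda>s. refreshed_drift (flow f s z)" and ?W' = "\<lambda>s. cross_drift (flow f s z)"
    let ?q = "\<lambda>s. exp (- (4 * lam * s))"
    (* The expected Lyapunov function after a step of length s, with the desired decay
       divided out; the claim is that it grows at most quadratically in h. *)
    let ?g = "\<lambda>s. exp (lam * s) * (?V s + ?q s * ?W s)"
    have "?g h \<le> ?g 0 + (exp (lam * T) * (4 * lam * h) * K') * h"
    proof (rule real_increment_le[OF h(1)])
      fix s assume s: "0 \<le> s" "s \<le> h"
      let ?g' = "exp (lam * s) * ((1 - ?q s) * (lam * ?V s + ?V' s)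
        + ?q s * (lam * (?V s + ?W s) + (?V' s + ?W' s) - 4 * lam * ?W s))"
      show "(?g has_real_derivative ?g') (at s within {0..})"
        by (rule derivative_eq_intros refl lyapunov_refresh_flow_deriv[OF s(1)]
            cross_flow_deriv[OF s(1)])+ (simp add: algebra_simps)
      have in_sub: "flow f s z \<in> sublevel c" using flow_in_sublevel[OF s(1) z] .
      have q: "0 \<le> 1 - ?q s" "1 - ?q s \<le> 4 * lam * h"
      proof -
        show "0 \<le> 1 - ?q s" using s lam_pos by simp
        have "1 - ?q s \<le> 4 * lam * s"
          using exp_ge_add_one_self[of "- (4 * lam * s)"] by simp
        also have "\<dots> \<le> 4 * lam * h" using s lam_pos by simp
        finally show "1 - ?q s \<le> 4 * lam * h" .
      qed
      have "?g' \<le> exp (lam * s) * ((1 - ?q s) * (lam * ?V s + ?V' s))"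
      proof -
        have "lam * (?V s + ?W s) + (?V' s + ?W' s) - 4 * lam * ?W s \<le> 0"
          using drift_nonpos[of "flow f s z"]
          unfolding lyapunov_eq_refresh_cross[of "flow f s z"] .
        then have "?q s * (lam * (?V s + ?W s) + (?V' s + ?W' s) - 4 * lam * ?W s) \<le> 0"
          by (intro mult_nonneg_nonpos) simp_all
        then show ?thesis by (intro mult_left_mono) simp_all
      qed
      also have "\<dots> \<le> exp (lam * s) * ((1 - ?q s) * K')"
        using K'(2)[OF in_sub] q(1) by (intro mult_left_mono) simp_all
      also have "\<dots> \<le> exp (lam * T) * ((4 * lam * h) * K')"
        using q s h lam_pos K'(1) by (intro mult_mono) simp_all
      finally show "?g' \<le> exp (lam * T) * (4 * lam * h) * K'" by (simp only: mult.assoc)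
    qed
    also have "?g 0 = lyapunov z"
      by (simp add: lyapunov_eq_refresh_cross[of z])
    also have "exp (lam * T) * (4 * lam * h) * K' * h = ?C * h\<^sup>2"
      by (simp add: power2_eq_square)
    finally have "exp (- (lam * h)) * ?g h \<le> exp (- (lam * h)) * (lyapunov z + ?C * h\<^sup>2)"
      by (intro mult_left_mono) simp_all
    also have "exp (- (lam * h)) * ?g h = ?V h + ?q h * ?W h"
      by (simp add: mult.assoc[symmetric] flip: exp_add)
    also have "exp (- (lam * h)) * (lyapunov z + ?C * h\<^sup>2)
        \<le> exp (- (lam * h)) * lyapunov z + ?C * h\<^sup>2"
    proof -
      have "exp (- (lam * h)) * (?C * h\<^sup>2) \<le> ?C * h\<^sup>2"
        using lam_pos h(1) K'(1) by (intro mult_left_le_one_le) simp_all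
      then show ?thesis by (simp add: distrib_left)
    qed
    finally show "?V h + ?q h * ?W h \<le> exp (- (lam * h)) * lyapunov z + ?C * h\<^sup>2" .
  qed
qed

end

section \<open>The Hamiltonian flow refreshed on a time grid\<close>

text \<open>
  The refreshed flow observed at the multiples of \<open>h\<close>, where \<open>N i\<close> is the number of events in the
  \<open>i\<close>-th grid interval and all of them are moved to its right end.  It depends on finitely many
  counts only, so measurability and independence are elementary for it.
\<close>

primrec grid_chain ::
  "('a::euclidean_space \<Rightarrow> real) \<Rightarrow> real \<Rightarrow> 'a \<times> 'a \<Rightarrow> (nat \<Rightarrow> nat) \<Rightarrow> nat \<Rightarrow> 'a \<times> 'a" where
  "grid_chain f h z N 0 = z"
| "grid_chain f h z N (Suc i) =
    (if N i = 0 then flow f h (grid_chain f h z N i) else refresh (flow f h (grid_chain f h z N i)))"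

lemma grid_chain_cong:
  "(\<And>j. j < i \<Longrightarrow> N j = N' j) \<Longrightarrow> grid_chain f h z N i = grid_chain f h z N' i"
  by (induction i) auto

context strongly_convex_flow
begin

lemma refresh_in_sublevel: "z \<in> sublevel c \<Longrightarrow> refresh z \<in> sublevel c"
  by (simp add: energy_def) (smt (verit) divide_nonneg_pos zero_le_power2)

lemma grid_chain_in_sublevel:
  "\<lbrakk>0 \<le> h; z \<in> sublevel c\<rbrakk> \<Longrightarrow> grid_chain f h z N i \<in> sublevel c"
  by (induction i) (simp_all only: grid_chain.simps flow_in_sublevel refresh_in_sublevel
      split: if_split, simp)

text \<open>
  The semigroup property, from autonomy and uniqueness.
\<close>

lemma flow_add:
  assumes "0 \<le> s" "0 \<le> t"
  shows "flow f (s + t) z = flow f t (flow f s z)"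
proof -
  have "hamiltonian_solution f {0..} (\<lambda>r. fst (flow f (s + r) z)) (\<lambda>r. snd (flow f (s + r) z))"
  proof (rule hamiltonian_solution_shift)
    show "hamiltonian_solution f ((+) s ` {0..}) (\<lambda>r. fst (flow f r z)) (\<lambda>r. snd (flow f r z))"
      using assms(1) by (intro hamiltonian_solution_subset[OF flow_solution]) auto
  qed
  from global_solution_eq_flow[OF this assms(2)] show ?thesis by simp
qed

lemma grid_chain_no_refresh:
  assumes "0 \<le> h" "\<And>j. \<lbrakk>i \<le> j; j < i + m\<rbrakk> \<Longrightarrow> N j = 0"
  shows "grid_chain f h z N (i + m) = flow f (real m * h) (grid_chain f h z N i)"
  using assms(2)
proof (induction m)
  case (Suc m)
  then have "grid_chain f h z N (i + m) = flow f (real m * h) (grid_chain f h z N i)" by simp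
  moreover have "N (i + m) = 0" by (rule Suc.prems) auto
  ultimately have "grid_chain f h z N (i + Suc m)
      = flow f h (flow f (real m * h) (grid_chain f h z N i))"
    by simp
  also have "\<dots> = flow f (real m * h + h) (grid_chain f h z N i)"
    using assms(1) by (intro flow_add[symmetric]) simp_all
  finally show ?case by (simp add: algebra_simps)
qed simp

end

section \<open>Convergence of the grid approximation along one path\<close>

lemma event_free_interval_after:
  fixes E :: "real set"
  assumes "finite (E \<inter> {0..s + 1})" "0 \<le> s"
  obtains e where "0 < e" "E \<inter> {s<..<s + e} = {}"
proof -
  let ?S = "E \<inter> {s<..s + 1}"
  have fin: "finite ?S"
    using assms by (intro finite_subset[OF _ assms(1)]) auto
  show thesis
  proof (cases "?S = {}")
    case True
    show thesis by (rule that[of 1]) (use True in auto)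
  next
    case False
    have "Min ?S \<in> ?S" using fin False by (rule Min_in)
    moreover have "E \<inter> {s<..<s + (Min ?S - s)} = {}"
    proof (rule ccontr)
      assume "E \<inter> {s<..<s + (Min ?S - s)} \<noteq> {}"
      then obtain r where r: "r \<in> E" "s < r" "r < Min ?S" by auto
      then have "r \<in> ?S" using \<open>Min ?S \<in> ?S\<close> by auto
      then show False using Min_le[OF fin] r(3) by force
    qed
    ultimately show thesis by (intro that[of "Min ?S - s"]) auto
  qed
qed

abbreviation grid_index :: "real \<Rightarrow> real \<Rightarrow> nat" where
  "grid_index h s \<equiv> nat \<lceil>s / h\<rceil>"

lemma grid_index_bounds:
  assumes "0 < h" "0 \<le> s"
  shows "s \<le> real (grid_index h s) * h" "real (grid_index h s) * h < s + h"
proof -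
  have k: "real (grid_index h s) = of_int \<lceil>s / h\<rceil>"
    using assms by (simp add: zero_le_divide_iff)
  show "s \<le> real (grid_index h s) * h"
    unfolding k by (rule iffD1[OF pos_divide_le_eq[OF assms(1)] le_of_int_ceiling])
  have "of_int \<lceil>s / h\<rceil> < s / h + 1" by linarith
  then have "of_int \<lceil>s / h\<rceil> * h < (s / h + 1) * h"
    using assms(1) by (rule mult_strict_right_mono)
  then show "real (grid_index h s) * h < s + h"
    unfolding k using assms(1) by (simp add: distrib_right)
qed

text \<open>
  The intervals are open on the left and closed on the right, so that they are disjoint and an event
  at a grid point resets the velocity at that very point.
\<close>

definition grid_counts :: "real set \<Rightarrow> real \<Rightarrow> nat \<Rightarrow> nat" where
  "grid_counts E h i = card (E \<inter> {real i * h<..real (Suc i) * h})"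

context strongly_convex_flow
begin

text \<open>
  The properties that almost every realization of the randomized flow with event set \<open>E\<close> has.
\<close>

definition refreshed_path :: "real set \<Rightarrow> (real \<Rightarrow> 'a) \<Rightarrow> (real \<Rightarrow> 'a) \<Rightarrow> bool" where
  "refreshed_path E x y \<longleftrightarrow> continuous_on {0..} x \<and>
    (\<forall>a b. 0 \<le> a \<and> a < b \<and> E \<inter> {a<..<b} = {} \<longrightarrow> hamiltonian_solution f {a..<b} x y) \<and>
    (\<forall>s\<in>E. y s = 0) \<and> (\<forall>b. finite (E \<inter> {0..b}))"

lemma half_open_solution_eq_flow:
  assumes "hamiltonian_solution f {a..<b} x y" "a \<le> r" "r < b"
  shows "(x r, y r) = flow f (r - a) (x a, y a)"
proof -
  have "(+) a ` {0..r - a} \<subseteq> {a..<b}"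
    using assms(3) by auto
  from solution_eq_flow[OF hamiltonian_solution_shift[OF
        hamiltonian_solution_subset[OF assms(1) this]], of "r - a"]
  show ?thesis using assms(2) by simp
qed

lemma flow_tendsto_in_time:
  assumes "\<And>n. 0 \<le> r n" "r \<longlonglongrightarrow> r'"
  shows "(\<lambda>n. flow f (r n) z) \<longlonglongrightarrow> flow f r' z"
  by (rule flow_jointly_continuous[OF assms, where c = "energy f z"]) simp_all

text \<open>
  Across an event-free open interval the path follows the flow.  If the right end is not an event,
  the solution extends a little beyond it; if it is one, continuity of the position and the reset of
  the velocity determine the state.
\<close>

lemma refreshed_path_step:
  assumes path: "refreshed_path E x y" and s: "0 \<le> s" "s < s'" and free: "E \<inter> {s<..<s'} = {}"
  shows "(x s', y s') =
    (if s' \<in> E then refresh else id) (flow f (s' - s) (x s, y s))"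
proof (cases "s' \<in> E")
  case True
  let ?z = "(x s, y s)"
  (* A sequence in [s, s') that increases to s'. *)
  let ?r = "\<lambda>n. s' - (s' - s) / real (Suc n)"
  have sol: "hamiltonian_solution f {s..<s'} x y"
    using path s free by (simp add: refreshed_path_def)
  have r: "s \<le> ?r n" "?r n < s'" for n
  proof -
    have "(s' - s) / real (Suc n) \<le> s' - s"
      using s(2) by (simp add: divide_le_eq mult_left_le flip: of_nat_Suc)
    then show "s \<le> ?r n" by simp
    show "?r n < s'" using s(2) by simp
  qed
  have r_lim: "?r \<longlonglongrightarrow> s'"
    using tendsto_diff[OF tendsto_const LIMSEQ_Suc[OF lim_const_over_n[of "s' - s"]], of s'] by simp
  have "(\<lambda>n. flow f (?r n - s) ?z) \<longlonglongrightarrow> flow f (s' - s) ?z"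
    by (rule flow_tendsto_in_time) (use r tendsto_diff[OF r_lim tendsto_const[of s]] in auto)
  then have "(\<lambda>n. fst (flow f (?r n - s) ?z)) \<longlonglongrightarrow> fst (flow f (s' - s) ?z)"
    by (rule tendsto_fst)
  moreover have "fst (flow f (?r n - s) ?z) = x (?r n)" for n
    by (simp only: half_open_solution_eq_flow[OF sol r, symmetric] fst_conv)
  ultimately have "(\<lambda>n. x (?r n)) \<longlonglongrightarrow> fst (flow f (s' - s) ?z)"
    by (simp only:)
  moreover have "(\<lambda>n. x (?r n)) \<longlonglongrightarrow> x s'"
  proof (rule continuous_on_tendsto_compose[OF _ r_lim])
    show "continuous_on {0..} x" using path by (simp add: refreshed_path_def)
    show "\<forall>\<^sub>F n in sequentially. ?r n \<in> {0..}"
      using order_trans[OF s(1) r(1)] by (intro always_eventually allI) (simp only: atLeast_iff)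
  qed (use s in simp)
  ultimately have "x s' = fst (flow f (s' - s) ?z)"
    by (rule LIMSEQ_unique[rotated])
  moreover have "y s' = 0" using path True by (simp add: refreshed_path_def)
  ultimately show ?thesis using True by (simp add: refresh_def)
next
  case False
  obtain e where e: "0 < e" "E \<inter> {s'<..<s' + e} = {}"
    using event_free_interval_after[of E s'] path s by (auto simp: refreshed_path_def)
  have "E \<inter> {s<..<s' + e} = {}"
  proof -
    have "{s<..<s' + e} \<subseteq> {s<..<s'} \<union> {s'} \<union> {s'<..<s' + e}" by auto
    then show ?thesis using free e(2) False by blast
  qed
  then have "hamiltonian_solution f {s..<s' + e} x y"
    using path s e(1) by (simp add: refreshed_path_def)
  from half_open_solution_eq_flow[OF this, of s'] show ?thesis
    using False s e(1) by simp
qed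

text \<open>
  The chain makes the same kind of move between the first grid points after \<open>s\<close> and \<open>s'\<close> as the
  path does between \<open>s\<close> and \<open>s'\<close>: all grid intervals in between except the last are free of
  events, and the last one reaches less than \<open>h\<close> beyond \<open>s'\<close> and so contains no event but \<open>s'\<close>.
\<close>

lemma grid_chain_step:
  assumes h: "0 < h" "h \<le> s' - s" and s: "0 \<le> s" "s < s'"
    and free: "E \<inter> {s<..<s'} = {}" "E \<inter> {s'<..<s' + h} = {}"
  defines "a \<equiv> grid_index h s" and "b \<equiv> grid_index h s'"
  shows "grid_chain f h z (grid_counts E h) b =
    (if s' \<in> E then refresh else id)
      (flow f (real b * h - real a * h) (grid_chain f h z (grid_counts E h) a))"
proof -
  have a: "s \<le> real a * h" "real a * h < s + h" and b: "s' \<le> real b * h" "real b * h < s' + h"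
    using grid_index_bounds[of h s] grid_index_bounds[of h s'] h s by (simp_all add: a_def b_def)
  then have "real a * h < real b * h" using h by linarith
  then have "a < b" using h by simp
  then obtain m where m: "b = Suc (a + m)" using less_imp_Suc_add by blast
  let ?I = "\<lambda>j. {real j * h<..real (Suc j) * h}"
  let ?N = "grid_counts E h"
  have before: "real (a + m) * h < s'"
    using b(2) unfolding m by (simp add: distrib_right)
  have start: "s \<le> real j * h" if "a \<le> j" for j
  proof -
    have "real a * h \<le> real j * h" using that h by (intro mult_right_mono) simp_all
    then show ?thesis using a(1) by linarith
  qed
  have "?N j = 0" if "a \<le> j" "j < a + m" for j
  proof -
    have "real (Suc j) * h \<le> real (a + m) * h" using that h by (intro mult_right_mono) simp_all
    then have "?I j \<subseteq> {s<..<s'}" using start[OF that(1)] before by auto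
    then have "E \<inter> ?I j = {}" using free(1) by blast
    then show ?thesis by (simp add: grid_counts_def)
  qed
  then have "grid_chain f h z ?N (a + m) = flow f (real m * h) (grid_chain f h z ?N a)"
    by (rule grid_chain_no_refresh[OF less_imp_le[OF h(1)]])
  then have "flow f h (grid_chain f h z ?N (a + m))
      = flow f (real m * h + h) (grid_chain f h z ?N a)"
    using h(1) by (simp add: flow_add)
  also have "real m * h + h = real b * h - real a * h"
    unfolding m by (simp add: algebra_simps)
  finally have last: "flow f h (grid_chain f h z ?N (a + m))
      = flow f (real b * h - real a * h) (grid_chain f h z ?N a)" .
  have "E \<inter> ?I (a + m) = E \<inter> {s'}"
  proof -
    have upper: "s' \<le> real (Suc (a + m)) * h" "real (Suc (a + m)) * h < s' + h"
      using b unfolding m .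
    have "?I (a + m) \<subseteq> {s<..<s'} \<union> {s'} \<union> {s'<..<s' + h}"
      using start[of "a + m"] upper by auto
    moreover have "s' \<in> ?I (a + m)" using before upper by simp
    ultimately show ?thesis using free by blast
  qed
  then have "?N (a + m) = (if s' \<in> E then 1 else 0)"
    by (simp add: grid_counts_def)
  then show "grid_chain f h z ?N b = (if s' \<in> E then refresh else id)
      (flow f (real b * h - real a * h) (grid_chain f h z ?N a))"
    unfolding m grid_chain.simps last[unfolded m] by simp
qed

lemma grid_chain_tendsto_step:
  assumes path: "refreshed_path E x y"
    and h: "\<And>n. 0 < h n" "h \<longlonglongrightarrow> 0" and s: "0 \<le> s" "s < s'" and free: "E \<inter> {s<..<s'} = {}"
    and lim: "(\<lambda>n. grid_chain f (h n) z (grid_counts E (h n)) (grid_index (h n) s)) \<longlonglongrightarrow> (x s, y s)"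
  shows "(\<lambda>n. grid_chain f (h n) z (grid_counts E (h n)) (grid_index (h n) s')) \<longlonglongrightarrow> (x s', y s')"
proof -
  let ?R = "if s' \<in> E then refresh else id"
  let ?z = "\<lambda>n. grid_chain f (h n) z (grid_counts E (h n)) (grid_index (h n) s)"
  let ?d = "\<lambda>n. real (grid_index (h n) s') * h n - real (grid_index (h n) s) * h n"
  obtain e where e: "0 < e" "E \<inter> {s'<..<s' + e} = {}"
    using event_free_interval_after[of E s'] path s by (auto simp: refreshed_path_def)
  have grid_lim: "(\<lambda>n. real (grid_index (h n) r) * h n) \<longlonglongrightarrow> r" if "0 \<le> r" for r
  proof (rule real_tendsto_sandwich)
    show "\<forall>\<^sub>F n in sequentially. r \<le> real (grid_index (h n) r) * h n"
      using grid_index_bounds(1)[OF h(1) that] by (intro always_eventually allI)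
    show "\<forall>\<^sub>F n in sequentially. real (grid_index (h n) r) * h n \<le> r + h n"
      using less_imp_le[OF grid_index_bounds(2)[OF h(1) that]] by (intro always_eventually allI)
    show "(\<lambda>n. r + h n) \<longlonglongrightarrow> r" using tendsto_add[OF tendsto_const h(2), of r] by simp
  qed simp
  have d_lim: "?d \<longlonglongrightarrow> s' - s"
    using s by (intro tendsto_diff grid_lim) simp_all
  have d_nonneg: "0 \<le> ?d n" for n
  proof -
    have "grid_index (h n) s \<le> grid_index (h n) s'"
      using s h(1)[of n] by (intro nat_mono ceiling_mono divide_right_mono) simp_all
    then show ?thesis using h(1)[of n] by simp
  qed
  have "(\<lambda>n. flow f (?d n) (?z n)) \<longlonglongrightarrow> flow f (s' - s) (x s, y s)"
  proof (rule flow_jointly_continuous[OF d_nonneg d_lim _ lim])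
    show "?z n \<in> sublevel (energy f z)" for n
      by (rule grid_chain_in_sublevel) (simp_all add: less_imp_le[OF h(1)])
  qed
  then have "(\<lambda>n. ?R (flow f (?d n) (?z n))) \<longlonglongrightarrow> ?R (flow f (s' - s) (x s, y s))"
    by (auto simp: refresh_def intro!: tendsto_Pair tendsto_fst)
  also have "?R (flow f (s' - s) (x s, y s)) = (x s', y s')"
    by (rule refreshed_path_step[OF path s free, symmetric])
  finally show ?thesis
  proof (rule Lim_transform_eventually)
    have "\<forall>\<^sub>F n in sequentially. h n < min e (s' - s)"
      by (rule order_tendstoD(2)[OF h(2)]) (use e(1) s(2) in simp)
    then show "\<forall>\<^sub>F n in sequentially. ?R (flow f (?d n) (?z n)) =
        grid_chain f (h n) z (grid_counts E (h n)) (grid_index (h n) s')"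
    proof eventually_elim
      case (elim n)
      have "E \<inter> {s'<..<s' + h n} = {}"
        using e(2) elim by auto
      from grid_chain_step[OF h(1)[of n] _ s free this, of z] elim show ?case by simp
    qed
  qed
qed

text \<open>
  A finite number of events precedes \<open>s\<close>, and the induction runs over that number: the convergence
  at the last event before \<open>s\<close> is carried to \<open>s\<close> by the continuity of the flow.
\<close>

lemma grid_chain_tendsto_path:
  assumes path: "refreshed_path E x y"
    and h: "\<And>n. 0 < h n" "h \<longlonglongrightarrow> 0" and s: "0 \<le> s"
  shows "(\<lambda>n. grid_chain f (h n) (x 0, y 0) (grid_counts E (h n)) (grid_index (h n) s))
    \<longlonglongrightarrow> (x s, y s)"
  using s
proof (induction "card (E \<inter> {0<..<s})" arbitrary: s rule: less_induct)
  case less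
  let ?S = "\<lambda>s. E \<inter> {0<..<s}"
  have fin: "finite (?S s)"
  proof (rule finite_subset)
    show "finite (E \<inter> {0..s})" using path by (simp add: refreshed_path_def)
  qed auto
  consider "s = 0" | "0 < s" "?S s = {}" | "?S s \<noteq> {}" using less.prems by force
  then show ?case
  proof cases
    case 2
    show ?thesis
      by (rule grid_chain_tendsto_step[OF path h order_refl 2]) simp
  next
    case 3
    define r where "r = Max (?S s)"
    have r: "r \<in> ?S s" unfolding r_def using fin 3 by (rule Max_in)
    have "?S r \<subset> ?S s" using r by auto
    then have smaller: "card (?S r) < card (?S s)" by (rule psubset_card_mono[OF fin])
    have r_bounds: "0 \<le> r" "r < s" using r by auto
    have free: "E \<inter> {r<..<s} = {}"
    proof (rule ccontr)
      assume "E \<inter> {r<..<s} \<noteq> {}"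
      then obtain q where q: "q \<in> E" "r < q" "q < s" by auto
      then have "q \<in> ?S s" using r by auto
      then have "q \<le> r" unfolding r_def by (rule Max_ge[OF fin])
      then show False using q(2) by simp
    qed
    show ?thesis
      by (rule grid_chain_tendsto_step[OF path h r_bounds free
            less.hyps[OF smaller r_bounds(1)]])
  qed simp
qed

end

section \<open>The expected decay\<close>

text \<open>
  The Markov property on the grid: a function of the counts before \<open>i\<close> is independent of the
  \<open>i\<close>-th count.  Functions of finitely many counts are measurable without further ado, because
  a finite product of countable discrete spaces is discrete.
\<close>

lemma (in prob_space) indep_past_present:
  fixes N :: "nat \<Rightarrow> 'a \<Rightarrow> nat" and G :: "(nat \<Rightarrow> nat) \<Rightarrow> real"
  assumes indep: "indep_vars (\<lambda>_. count_space UNIV) N UNIV"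
    and past: "\<And>v w. (\<And>j. j < i \<Longrightarrow> v j = w j) \<Longrightarrow> G v = G w"
    and bounded: "\<And>v. \<bar>G v\<bar> \<le> B"
  shows "integrable M (\<lambda>\<omega>. G (\<lambda>j. N j \<omega>))"
    and "integrable M (\<lambda>\<omega>. G (\<lambda>j. N j \<omega>) * of_bool (N i \<omega> = 0))"
    and "(LINT \<omega>|M. G (\<lambda>j. N j \<omega>) * of_bool (N i \<omega> = 0)) =
      (LINT \<omega>|M. G (\<lambda>j. N j \<omega>)) * prob {\<omega> \<in> space M. N i \<omega> = 0}"
proof -
  have [measurable]: "N j \<in> measurable M (count_space UNIV)" for j
    using indep by (auto simp: indep_vars_def2)
  let ?F = "\<lambda>v. of_bool (v i = 0) :: real"
  have "indep_var
      (PiM {..<i} (\<lambda>_. count_space UNIV)) (\<lambda>\<omega>. restrict (\<lambda>j. N j \<omega>) {..<i})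
      (PiM {i} (\<lambda>_. count_space UNIV)) (\<lambda>\<omega>. restrict (\<lambda>j. N j \<omega>) {i})"
    by (rule indep_var_restrict[OF indep]) auto
  then have "indep_var borel (G \<circ> (\<lambda>\<omega>. restrict (\<lambda>j. N j \<omega>) {..<i}))
      borel (?F \<circ> (\<lambda>\<omega>. restrict (\<lambda>j. N j \<omega>) {i}))"
    by (rule indep_var_compose) (simp_all add: count_space_PiM_finite)
  moreover have "G \<circ> (\<lambda>\<omega>. restrict (\<lambda>j. N j \<omega>) {..<i}) = (\<lambda>\<omega>. G (\<lambda>j. N j \<omega>))"
    by (auto simp: fun_eq_iff intro!: past)
  moreover have "?F \<circ> (\<lambda>\<omega>. restrict (\<lambda>j. N j \<omega>) {i}) = (\<lambda>\<omega>. of_bool (N i \<omega> = 0))"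
    by (simp add: fun_eq_iff)
  ultimately have ind: "indep_var borel (\<lambda>\<omega>. G (\<lambda>j. N j \<omega>)) borel (\<lambda>\<omega>. of_bool (N i \<omega> = 0) :: real)"
    by (simp only:)
  have meas: "(\<lambda>\<omega>. G (\<lambda>j. N j \<omega>)) \<in> borel_measurable M"
    using indep_var_rv1[OF ind] .
  show int: "integrable M (\<lambda>\<omega>. G (\<lambda>j. N j \<omega>))"
    by (rule integrable_const_bound[of _ B]) (simp_all add: bounded meas)
  have int': "integrable M (\<lambda>\<omega>. of_bool (N i \<omega> = 0) :: real)"
    by (rule integrable_const_bound[of _ 1]) simp_all
  show "integrable M (\<lambda>\<omega>. G (\<lambda>j. N j \<omega>) * of_bool (N i \<omega> = 0))"
    using indep_var_integrable[OF ind int int'] .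
  have "(LINT \<omega>|M. of_bool (N i \<omega> = 0)) = (LINT \<omega>|M. indicator {\<omega> \<in> space M. N i \<omega> = 0} \<omega> :: real)"
    by (rule Bochner_Integration.integral_cong) (auto simp: indicator_def)
  also have "\<dots> = prob {\<omega> \<in> space M. N i \<omega> = 0}"
    by simp
  finally show "(LINT \<omega>|M. G (\<lambda>j. N j \<omega>) * of_bool (N i \<omega> = 0)) =
      (LINT \<omega>|M. G (\<lambda>j. N j \<omega>)) * prob {\<omega> \<in> space M. N i \<omega> = 0}"
    using indep_var_lebesgue_integral[OF ind int int'] by simp
qed

context strongly_convex_flow
begin

lemma bounded_on_sublevel:
  assumes "continuous_on UNIV \<phi>"
  obtains B where "\<forall>z\<in>sublevel c. \<bar>\<phi> z :: real\<bar> \<le> B"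
proof -
  have "bounded (\<phi> ` sublevel c)"
    by (intro compact_imp_bounded compact_continuous_image compact_sublevel
        continuous_on_subset[OF assms]) simp
  then obtain B where "\<And>z. z \<in> sublevel c \<Longrightarrow> norm (\<phi> z) \<le> B"
    by (rule bounded_imageE) (rule that)
  then show thesis by (intro that[of B] ballI) (simp only: real_norm_def)
qed

lemma continuous_on_lyapunov_refresh: "continuous_on S (\<lambda>z. lyapunov (refresh z))"
  unfolding lyapunov_refresh
  by (intro continuous_intros continuous_on_compose2[OF continuous_on_f[of UNIV]]) auto

lemma continuous_on_cross: "continuous_on S cross"
  unfolding cross_def[abs_def] by (intro continuous_intros) auto

lemma grid_chain_past_present:
  assumes "prob_space M"
    and indep: "prob_space.indep_vars M (\<lambda>_. count_space UNIV) N UNIV"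
    and h: "0 \<le> h" and z: "z \<in> sublevel c"
    and bounded: "\<forall>w\<in>sublevel c. \<bar>\<phi> w :: real\<bar> \<le> B"
  shows "integrable M (\<lambda>\<omega>. \<phi> (grid_chain f h z (\<lambda>j. N j \<omega>) i))"
    and "integrable M (\<lambda>\<omega>. \<phi> (grid_chain f h z (\<lambda>j. N j \<omega>) i) * of_bool (N i \<omega> = 0))"
    and "(LINT \<omega>|M. \<phi> (grid_chain f h z (\<lambda>j. N j \<omega>) i) * of_bool (N i \<omega> = 0)) =
      (LINT \<omega>|M. \<phi> (grid_chain f h z (\<lambda>j. N j \<omega>) i)) * measure M {\<omega> \<in> space M. N i \<omega> = 0}"
proof -
  interpret prob_space M by fact
  define G where "G v = \<phi> (grid_chain f h z v i)" for v
  have past: "G v = G w" if "\<And>j. j < i \<Longrightarrow> v j = w j" for v w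
    unfolding G_def by (rule arg_cong[where f = \<phi>]) (rule grid_chain_cong[OF that])
  have bnd: "\<bar>G v\<bar> \<le> B" for v
    unfolding G_def by (rule bspec[OF bounded grid_chain_in_sublevel[OF h z]])
  show "integrable M (\<lambda>\<omega>. \<phi> (grid_chain f h z (\<lambda>j. N j \<omega>) i))"
    using indep_past_present(1)[where G = G, OF indep past bnd] unfolding G_def .
  show "integrable M (\<lambda>\<omega>. \<phi> (grid_chain f h z (\<lambda>j. N j \<omega>) i) * of_bool (N i \<omega> = 0))"
    using indep_past_present(2)[where G = G, OF indep past bnd] unfolding G_def .
  show "(LINT \<omega>|M. \<phi> (grid_chain f h z (\<lambda>j. N j \<omega>) i) * of_bool (N i \<omega> = 0)) =
      (LINT \<omega>|M. \<phi> (grid_chain f h z (\<lambda>j. N j \<omega>) i)) * prob {\<omega> \<in> space M. N i \<omega> = 0}"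
    using indep_past_present(3)[where G = G, OF indep past bnd] unfolding G_def .
qed

text \<open>
  By independence the refreshment in step \<open>i\<close> can be averaged out separately, which reduces the
  expectation to \<open>one_step_contraction\<close> with an error \<open>D\<close>.
\<close>

lemma grid_chain_expectation_step:
  assumes "prob_space M"
    and indep: "prob_space.indep_vars M (\<lambda>_. count_space UNIV) N UNIV"
    and void: "\<And>i. measure M {\<omega> \<in> space M. N i \<omega> = 0} = exp (- (4 * lam * h))"
    and h: "0 \<le> h" and z: "z \<in> sublevel c"
    and step: "\<And>w. w \<in> sublevel c \<Longrightarrow>
      lyapunov (refresh (flow f h w)) + exp (- (4 * lam * h)) * cross (flow f h w)
        \<le> exp (- (lam * h)) * lyapunov w + D"
  shows "(LINT \<omega>|M. lyapunov (grid_chain f h z (\<lambda>j. N j \<omega>) (Suc i)))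
    \<le> exp (- (lam * h)) * (LINT \<omega>|M. lyapunov (grid_chain f h z (\<lambda>j. N j \<omega>) i)) + D"
proof -
  interpret prob_space M by fact
  let ?Z = "\<lambda>v. grid_chain f h z v i"
  let ?w = "\<lambda>v. flow f h (?Z v)"
  note Z = grid_chain_in_sublevel[OF h z]
  obtain B1 where B1: "\<forall>z\<in>sublevel c. \<bar>lyapunov z\<bar> \<le> B1"
    by (rule bounded_on_sublevel[OF continuous_on_lyapunov]) (rule that)
  obtain B2 where B2: "\<forall>z\<in>sublevel c. \<bar>lyapunov (refresh z)\<bar> \<le> B2"
    by (rule bounded_on_sublevel[OF continuous_on_lyapunov_refresh]) (rule that)
  obtain B3 where B3: "\<forall>z\<in>sublevel c. \<bar>cross z\<bar> \<le> B3"
    by (rule bounded_on_sublevel[OF continuous_on_cross]) (rule that)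
  have B2': "\<forall>w\<in>sublevel c. \<bar>lyapunov (refresh (flow f h w))\<bar> \<le> B2"
    by (intro ballI bspec[OF B2] flow_in_sublevel[OF h])
  have B3': "\<forall>w\<in>sublevel c. \<bar>cross (flow f h w)\<bar> \<le> B3"
    by (intro ballI bspec[OF B3] flow_in_sublevel[OF h])
  note int_L = grid_chain_past_present(1)[where \<phi> = lyapunov and i = i,
      OF assms(1) indep h z B1]
  note int_V = grid_chain_past_present(1)[where \<phi> = "\<lambda>w. lyapunov (refresh (flow f h w))"
      and i = i, OF assms(1) indep h z B2']
  note W = grid_chain_past_present[where \<phi> = "\<lambda>w. cross (flow f h w)" and i = i,
      OF assms(1) indep h z B3']
  have "(LINT \<omega>|M. lyapunov (grid_chain f h z (\<lambda>j. N j \<omega>) (Suc i)))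
      = (LINT \<omega>|M. lyapunov (refresh (?w (\<lambda>j. N j \<omega>)))
          + cross (?w (\<lambda>j. N j \<omega>)) * of_bool (N i \<omega> = 0))"
  proof (rule Bochner_Integration.integral_cong[OF refl])
    fix \<omega>
    show "lyapunov (grid_chain f h z (\<lambda>j. N j \<omega>) (Suc i)) =
        lyapunov (refresh (?w (\<lambda>j. N j \<omega>))) + cross (?w (\<lambda>j. N j \<omega>)) * of_bool (N i \<omega> = 0)"
      using lyapunov_eq_refresh_cross[of "?w (\<lambda>j. N j \<omega>)"] by simp
  qed
  also have "\<dots> = (LINT \<omega>|M. lyapunov (refresh (?w (\<lambda>j. N j \<omega>))))
      + exp (- (4 * lam * h)) * (LINT \<omega>|M. cross (?w (\<lambda>j. N j \<omega>)))"
    by (simp add: Bochner_Integration.integral_add[OF int_V W(2)] W(3) void)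
  also have "\<dots> = (LINT \<omega>|M. lyapunov (refresh (?w (\<lambda>j. N j \<omega>)))
      + exp (- (4 * lam * h)) * cross (?w (\<lambda>j. N j \<omega>)))"
    using int_V W(1) by simp
  also have "\<dots> \<le> (LINT \<omega>|M. exp (- (lam * h)) * lyapunov (?Z (\<lambda>j. N j \<omega>)) + D)"
    using int_V W(1) int_L by (intro integral_mono step Z) simp_all
  also have "\<dots> = exp (- (lam * h)) * (LINT \<omega>|M. lyapunov (?Z (\<lambda>j. N j \<omega>))) + D"
    using int_L by (simp add: prob_space)
  finally show ?thesis .
qed

lemma grid_chain_expectation:
  assumes "prob_space M"
    and "prob_space.indep_vars M (\<lambda>_. count_space UNIV) N UNIV"
    and "\<And>i. measure M {\<omega> \<in> space M. N i \<omega> = 0} = exp (- (4 * lam * h))"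
    and h: "0 \<le> h" and "z \<in> sublevel c"
    and "\<And>w. w \<in> sublevel c \<Longrightarrow>
      lyapunov (refresh (flow f h w)) + exp (- (4 * lam * h)) * cross (flow f h w)
        \<le> exp (- (lam * h)) * lyapunov w + D"
    and D: "0 \<le> D"
  shows "(LINT \<omega>|M. lyapunov (grid_chain f h z (\<lambda>j. N j \<omega>) n))
    \<le> exp (- (lam * (real n * h))) * lyapunov z + real n * D"
proof (induction n)
  case 0
  interpret prob_space M by fact
  show ?case by (simp add: prob_space)
next
  case (Suc n)
  let ?e = "exp (- (lam * h))"
  have "(LINT \<omega>|M. lyapunov (grid_chain f h z (\<lambda>j. N j \<omega>) (Suc n)))
      \<le> ?e * (LINT \<omega>|M. lyapunov (grid_chain f h z (\<lambda>j. N j \<omega>) n)) + D"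
    by (rule grid_chain_expectation_step[OF assms(1-6)])
  also have "\<dots> \<le> ?e * (exp (- (lam * (real n * h))) * lyapunov z + real n * D) + D"
    using Suc.IH by simp
  also have "\<dots> = exp (- (lam * (real (Suc n) * h))) * lyapunov z + ?e * (real n * D) + D"
    by (simp add: distrib_left algebra_simps flip: exp_add)
  also have "?e * (real n * D) \<le> real n * D"
    using lam_pos h D by (intro mult_left_le_one_le) simp_all
  finally show ?case by (simp add: algebra_simps)
qed

lemma poisson_grid_counts:
  assumes poisson: "poisson_point_process M (\<lambda>_. g) E" and h: "0 < h"
  shows "prob_space.indep_vars M (\<lambda>_. count_space UNIV) (\<lambda>i \<omega>. grid_counts (E \<omega>) h i) UNIV"
    and "measure M {\<omega> \<in> space M. grid_counts (E \<omega>) h i = 0} = exp (- (g * h))"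
proof -
  let ?A = "\<lambda>i. {real i * h<..real (Suc i) * h}"
  have A: "?A i \<in> sets borel \<and> ?A i \<subseteq> {0..} \<and> bounded (?A i)" for i
  proof (intro conjI)
    have "0 \<le> real i * h" using h by simp
    then show "?A i \<subseteq> {0..}" by (auto simp del: of_nat_Suc)
  qed auto
  have disj: "disjoint_family ?A"
    unfolding disjoint_family_on_def
  proof (intro ballI impI)
    fix i j :: nat assume "i \<noteq> j"
    have less: "?A i \<inter> ?A j = {}" if "i < j" for i j :: nat
    proof -
      have "real (Suc i) * h \<le> real j * h" using that h by (intro mult_right_mono) simp_all
      then show ?thesis by auto
    qed
    show "?A i \<inter> ?A j = {}"
    proof (cases "i < j")
      case False
      then have "?A j \<inter> ?A i = {}" using \<open>i \<noteq> j\<close> by (intro less) simp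
      then show ?thesis by (simp only: Int_commute)
    qed (rule less)
  qed
  have indep: "\<forall>A :: nat \<Rightarrow> real set.
      (\<forall>i. A i \<in> sets borel \<and> A i \<subseteq> {0..} \<and> bounded (A i)) \<and> disjoint_family A \<longrightarrow>
      prob_space.indep_vars M (\<lambda>_. count_space UNIV) (\<lambda>i \<omega>. card (E \<omega> \<inter> A i)) UNIV"
    using poisson unfolding poisson_point_process_def by (elim conjE)
  show "prob_space.indep_vars M (\<lambda>_. count_space UNIV) (\<lambda>i \<omega>. grid_counts (E \<omega>) h i) UNIV"
    unfolding grid_counts_def by (rule mp[OF spec[OF indep] conjI[OF allI[OF A] disj]])
  have length: "real (Suc i) * h - real i * h = h" by (simp add: algebra_simps)
  have "0 \<le> h" using h by simp
  then have le: "real i * h \<le> real (Suc i) * h" using length by linarith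
  have intensity: "(LINT s:?A i|lborel. g) = g * h"
    unfolding set_lebesgue_integral_def using le length by (simp del: of_nat_Suc)
  have counts: "\<forall>A\<in>sets borel. A \<subseteq> {0..} \<and> bounded A \<longrightarrow>
      (\<forall>k. measure M {\<omega> \<in> space M. card (E \<omega> \<inter> A) = k} =
        (LINT s:A|lborel. g) ^ k / fact k * exp (- (LINT s:A|lborel. g)))"
    using poisson unfolding poisson_point_process_def by (elim conjE)
  from spec[OF mp[OF bspec[OF counts conjunct1[OF A]] conjunct2[OF A]], of i 0]
  show "measure M {\<omega> \<in> space M. grid_counts (E \<omega>) h i = 0} = exp (- (g * h))"
    unfolding intensity grid_counts_def by simp
qed

text \<open>
  With the step size \<open>t / (n + 1)\<close> the accumulated error of the chain is \<open>(n + 1) * C * h\<^sup>2\<close>, which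
  tends to \<open>0\<close>, and dominated convergence transfers the estimate to the process.
\<close>

lemma expected_suboptimality_le:
  fixes X Y :: "real \<Rightarrow> 'w \<Rightarrow> 'a"
  assumes rhf: "randomized_hamiltonian_flow M f (\<lambda>_. 4 * lam) E X Y"
    and init: "AE \<omega> in M. X 0 \<omega> = x0 \<and> Y 0 \<omega> = 0" and t: "0 < t"
  shows "integrable M (\<lambda>\<omega>. f (X t \<omega>) - f xstar)"
    and "(LINT \<omega>|M. f (X t \<omega>) - f xstar) \<le> exp (- (lam * t)) * lyapunov (x0, 0)"
proof -
  have poisson: "poisson_point_process M (\<lambda>_. 4 * lam) E"
    and X_meas: "X t \<in> borel_measurable M"
    using rhf t unfolding randomized_hamiltonian_flow_def by auto
  interpret prob_space M
    using poisson unfolding poisson_point_process_def by blast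
  have "AE \<omega> in M. \<forall>b. finite (E \<omega> \<inter> {0..b})"
    using poisson unfolding poisson_point_process_def by auto
  moreover have "AE \<omega> in M. continuous_on {0..} (\<lambda>t. X t \<omega>) \<and>
      (\<forall>a b. 0 \<le> a \<and> a < b \<and> E \<omega> \<inter> {a<..<b} = {} \<longrightarrow>
        hamiltonian_solution f {a..<b} (\<lambda>t. X t \<omega>) (\<lambda>t. Y t \<omega>)) \<and> (\<forall>\<tau>\<in>E \<omega>. Y \<tau> \<omega> = 0)"
    using rhf unfolding randomized_hamiltonian_flow_def by blast
  ultimately have path: "AE \<omega> in M. refreshed_path (E \<omega>) (\<lambda>t. X t \<omega>) (\<lambda>t. Y t \<omega>)"
    by eventually_elim (simp add: refreshed_path_def)
  define h where "h n = t / real (Suc n)" for n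
  have h: "0 < h n" "h n \<le> t" "real (Suc n) * h n = t" for n
    using t by (simp_all add: h_def divide_le_eq mult_left_le flip: of_nat_Suc)
  have h_lim: "h \<longlonglongrightarrow> 0"
    unfolding h_def by (rule LIMSEQ_Suc[OF lim_const_over_n])
  have index: "grid_index (h n) t = Suc n" for n
  proof -
    have "t / h n = real (Suc n)" using h(1,3)[of n] by (simp add: field_simps)
    then show ?thesis by (simp del: of_nat_Suc)
  qed
  let ?z = "(x0, 0 :: 'a)"
  let ?c = "energy f ?z"
  let ?N = "\<lambda>n i \<omega>. grid_counts (E \<omega>) (h n) i"
  let ?Z = "\<lambda>n \<omega>. grid_chain f (h n) ?z (\<lambda>j. ?N n j \<omega>) (Suc n)"
  let ?\<phi> = "\<lambda>z. f (fst z) - f xstar"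
  have Z_in: "?Z n \<omega> \<in> sublevel ?c" for n \<omega>
    by (rule grid_chain_in_sublevel[OF less_imp_le[OF h(1)]]) simp
  have cont: "continuous_on UNIV ?\<phi>"
    by (intro continuous_intros continuous_on_compose2[OF continuous_on_f[of UNIV]]) auto
  obtain B where B: "\<forall>z\<in>sublevel ?c. \<bar>?\<phi> z\<bar> \<le> B"
    by (rule bounded_on_sublevel[OF cont]) (rule that)
  obtain B' where B': "\<forall>z\<in>sublevel ?c. \<bar>lyapunov z\<bar> \<le> B'"
    by (rule bounded_on_sublevel[OF continuous_on_lyapunov]) (rule that)
  note counts = poisson_grid_counts[OF poisson h(1)]
  have int_\<phi>: "integrable M (\<lambda>\<omega>. ?\<phi> (?Z n \<omega>))" for n
    by (rule grid_chain_past_present(1)[where \<phi> = ?\<phi>,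
          OF prob_space_axioms counts(1)[of n] less_imp_le[OF h(1)] _ B]) simp_all
  have int_L: "integrable M (\<lambda>\<omega>. lyapunov (?Z n \<omega>))" for n
    by (rule grid_chain_past_present(1)[where \<phi> = lyapunov,
          OF prob_space_axioms counts(1)[of n] less_imp_le[OF h(1)] _ B']) simp_all
  have Z_lim: "AE \<omega> in M. (\<lambda>n. ?\<phi> (?Z n \<omega>)) \<longlonglongrightarrow> f (X t \<omega>) - f xstar"
    using path init
  proof eventually_elim
    case (elim \<omega>)
    have "(\<lambda>n. ?Z n \<omega>) \<longlonglongrightarrow> (X t \<omega>, Y t \<omega>)"
      using grid_chain_tendsto_path[OF elim(1) h(1) h_lim less_imp_le[OF t]] elim(2)
      unfolding index by simp
    from tendsto_fst[OF this]
    have "(\<lambda>n. fst (?Z n \<omega>)) \<longlonglongrightarrow> X t \<omega>" by simp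
    from isCont_tendsto_compose[OF isCont_f this]
    show ?case by (rule tendsto_diff[OF _ tendsto_const])
  qed
  have X_f_meas: "(\<lambda>\<omega>. f (X t \<omega>) - f xstar) \<in> borel_measurable M"
    using measurable_compose[OF X_meas borel_measurable_continuous_onI[OF continuous_on_f]] by simp
  have bound: "AE \<omega> in M. norm (?\<phi> (?Z n \<omega>)) \<le> B" for n
    using bspec[OF B Z_in] by simp
  have w: "integrable M (\<lambda>_. B)" by simp
  show "integrable M (\<lambda>\<omega>. f (X t \<omega>) - f xstar)"
    by (rule integrable_dominated_convergence[OF X_f_meas _ w Z_lim bound])
      (rule borel_measurable_integrable[OF int_\<phi>])
  have lim: "(\<lambda>n. LINT \<omega>|M. ?\<phi> (?Z n \<omega>)) \<longlonglongrightarrow> (LINT \<omega>|M. f (X t \<omega>) - f xstar)"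
    by (rule integral_dominated_convergence[OF X_f_meas _ w Z_lim bound])
      (rule borel_measurable_integrable[OF int_\<phi>])
  obtain C where C: "0 \<le> C" "\<And>h z. \<lbrakk>0 \<le> h; h \<le> t; z \<in> sublevel ?c\<rbrakk> \<Longrightarrow>
      lyapunov (refresh (flow f h z)) + exp (- (4 * lam * h)) * cross (flow f h z)
        \<le> exp (- (lam * h)) * lyapunov z + C * h\<^sup>2"
    by (rule one_step_contraction) (rule that)
  have "(LINT \<omega>|M. ?\<phi> (?Z n \<omega>)) \<le> exp (- (lam * t)) * lyapunov ?z + C * t * h n" for n
  proof -
    have "(LINT \<omega>|M. ?\<phi> (?Z n \<omega>)) \<le> (LINT \<omega>|M. lyapunov (?Z n \<omega>))"
      by (rule integral_mono[OF int_\<phi> int_L suboptimality_le_lyapunov])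
    also have "\<dots> \<le> exp (- (lam * (real (Suc n) * h n))) * lyapunov ?z
        + real (Suc n) * (C * (h n)\<^sup>2)"
    proof (rule grid_chain_expectation[OF _ counts, where c = ?c])
      show "lyapunov (refresh (flow f (h n) w)) + exp (- (4 * lam * h n)) * cross (flow f (h n) w)
          \<le> exp (- (lam * h n)) * lyapunov w + C * (h n)\<^sup>2" if "w \<in> sublevel ?c" for w
        by (rule C(2)[OF less_imp_le[OF h(1)] h(2) that])
    qed (use C(1) less_imp_le[OF h(1)] in \<open>simp_all add: prob_space_axioms\<close>)
    also have "real (Suc n) * (C * (h n)\<^sup>2) = C * (real (Suc n) * h n) * h n"
      by (simp add: power2_eq_square)
    finally show ?thesis unfolding h(3) .
  qed
  moreover have "(\<lambda>n. exp (- (lam * t)) * lyapunov ?z + C * t * h n)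
      \<longlonglongrightarrow> exp (- (lam * t)) * lyapunov ?z"
    using tendsto_add[OF tendsto_const tendsto_mult_right_zero[OF h_lim]] by fastforce
  ultimately show "(LINT \<omega>|M. f (X t \<omega>) - f xstar) \<le> exp (- (lam * t)) * lyapunov ?z"
    using LIMSEQ_le[OF lim] by blast
qed

end

text \<open>
  The case \<open>t = 0\<close> is separate, because the grid needs a positive step size.
\<close>

theorem theorem2:
  fixes f :: "real ^ 'd \<Rightarrow> real" and \<alpha> t :: real and xstar x0 :: "real ^ 'd"
    and M :: "'w measure" and E :: "'w \<Rightarrow> real set"
    and X Y :: "real \<Rightarrow> 'w \<Rightarrow> real ^ 'd"
  assumes "0 < \<alpha>" and "\<alpha> \<le> 1"
    and "\<And>x. f differentiable (at x)"
    and "strongly_convex \<alpha> f"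
    and "\<And>x. f xstar \<le> f x"
    and "hamiltonian_flow_well_defined f"
    and "randomized_hamiltonian_flow M f (\<lambda>_. sqrt (16 * \<alpha> / 5)) E X Y"
    and "AE \<omega> in M. X 0 \<omega> = x0 \<and> Y 0 \<omega> = 0"
    and "t \<ge> 0"
  shows "integrable M (\<lambda>\<omega>. f (X t \<omega>) - f xstar) \<and>
    (LINT \<omega>|M. f (X t \<omega>) - f xstar) \<le>
      exp (- sqrt (\<alpha> / 5) * t) *
        (LINT \<omega>|M. f (X 0 \<omega>) - f xstar + \<alpha> / 10 * (norm (X 0 \<omega> - xstar))\<^sup>2)"
proof -
  interpret strongly_convex_flow f \<alpha> xstar
    by (rule strongly_convex_flow.intro) (fact assms)+
  interpret prob_space M
    using assms(7) unfolding randomized_hamiltonian_flow_def poisson_point_process_def by blast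
  have "sqrt (16 * \<alpha> / 5) = sqrt (4\<^sup>2 * (\<alpha> / 5))" by simp
  also have "\<dots> = 4 * sqrt (\<alpha> / 5)" by (simp only: real_sqrt_mult real_sqrt_abs abs_numeral)
  finally have rate: "sqrt (16 * \<alpha> / 5) = 4 * lam" unfolding lam_def .
  have X0_meas: "X 0 \<in> borel_measurable M"
    using assms(7) unfolding randomized_hamiltonian_flow_def by simp
  have f_meas: "f \<in> borel_measurable borel"
    by (rule borel_measurable_continuous_onI[OF continuous_on_f])
  have fX0_meas: "(\<lambda>\<omega>. f (X 0 \<omega>)) \<in> borel_measurable M"
    by (rule measurable_compose[OF X0_meas f_meas])
  have start: "(LINT \<omega>|M. f (X 0 \<omega>) - f xstar + \<alpha> / 10 * (norm (X 0 \<omega> - xstar))\<^sup>2)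
      = lyapunov (x0, 0)"
  proof -
    have "(LINT \<omega>|M. f (X 0 \<omega>) - f xstar + \<alpha> / 10 * (norm (X 0 \<omega> - xstar))\<^sup>2)
        = (LINT \<omega>|M. lyapunov (x0, 0))"
    proof (rule integral_cong_AE)
      show "AE \<omega> in M. f (X 0 \<omega>) - f xstar + \<alpha> / 10 * (norm (X 0 \<omega> - xstar))\<^sup>2 = lyapunov (x0, 0)"
        using assms(8)
        by eventually_elim (simp add: lyapunov_def power_mult_distrib lam_squared)
    qed (use fX0_meas X0_meas in measurable)
    then show ?thesis by (simp add: prob_space)
  qed
  show ?thesis
  proof (cases "t = 0")
    case True
    have AE_X0: "AE \<omega> in M. f (X 0 \<omega>) - f xstar = f x0 - f xstar"
      using assms(8) by eventually_elim simp
    have "integrable M (\<lambda>\<omega>. f (X 0 \<omega>) - f xstar)"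
      by (rule integrable_cong_AE_imp[OF _ _ AE_symmetric[OF AE_X0]])
        (use fX0_meas in simp_all)
    moreover have "(LINT \<omega>|M. f (X 0 \<omega>) - f xstar) = (LINT \<omega>|M. f x0 - f xstar)"
      by (rule integral_cong_AE[OF _ _ AE_X0]) (use fX0_meas in simp_all)
    ultimately show ?thesis
      unfolding start True using suboptimality_le_lyapunov[of "(x0, 0)"]
      by (simp add: prob_space)
  next
    case False
    then have "0 < t" using assms(9) by simp
    from expected_suboptimality_le[OF assms(7)[unfolded rate] assms(8) this]
    show ?thesis unfolding start by (simp add: lam_def)
  qed
qed

end
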